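(* Let $\mathbf{v}_1,\ldots,\mathbf{v}_k\in\mathbb{R}^k$, and let $F:\mathbb{R}^{kn}\to\mathbb{R}$, \[ F(\mathbf{w}_1,\ldots,\mathbf{w}_n)=\mathbb{E}_{\mathbf{x}\sim\mathcal{N}(\mathbf{0},I_k)}\left[\frac{1}{2}\left(\sum_{i=1}^{n}[\mathbf{w}_i^\top\mathbf{x}]_+-\sum_{i=1}^{k}[\mathbf{v}_i^\top\mathbf{x}]_+\right)^2\right]. \] Let $A\subseteq\mathbb{R}^{kn}$ be compact and suppose $F$ is thrice differentiable on $A$. Let $m_A=\min_{(\mathbf{w}_1,\ldots,\mathbf{w}_n)\in A}\min_{i}\|\mathbf{w}_i\|$, $M_A=\max_{(\mathbf{w}_1,\ldots,\mathbf{w}_n)\in A}\max_i\|\mathbf{w}_i\|$, $V=\max_j\|\mathbf{v}_j\|$, and \[ LH=\frac{1}{2}+n(n-1)\left(\frac{M_A}{2\pi m_A}+\frac{1}{2}\right)+\frac{nkV}{2\pi m_A}. \] Then for any $\mathbf{w},\mathbf{w}'\in A$, \[ |F(\mathbf{w}')-F(\mathbf{w})|\le\|\mathbf{w}'-\mathbf{w}\|\left(LH\,\|\mathbf{w}'-\mathbf{w}\|+\|\nabla F(\mathbf{w})\|\right). \]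
   Context: $[z]_+=\max\{0,z\}$; norms are Euclidean. *)

theory Defs
  imports "HOL-Probability.Probability"
begin

definition relu :: "real \<Rightarrow> real" where
  "relu z = max 0 z"

definition std_gauss :: "(real ^ 'k::finite) measure" where
  "std_gauss = density lborel (\<lambda>x. ennreal (\<Prod>i\<in>UNIV. std_normal_density (x $ i)))"

definition loss_F :: "(real ^ 'k) ^ 'k \<Rightarrow> (real ^ 'k::finite) ^ 'n::finite \<Rightarrow> real" where
  "loss_F v w = integral\<^sup>L std_gauss
     (\<lambda>x. 1/2 * ((\<Sum>i\<in>UNIV. relu (w $ i \<bullet> x)) - (\<Sum>j\<in>UNIV. relu (v $ j \<bullet> x)))\<^sup>2)"

definition thrice_differentiable_on :: "('a::euclidean_space \<Rightarrow> real) \<Rightarrow> 'a set \<Rightarrow> bool" where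
  "thrice_differentiable_on f A \<longleftrightarrow>
    (\<exists>S D1 D2 D3. open S \<and> A \<subseteq> S \<and>
       (\<forall>x\<in>S. (f has_derivative blinfun_apply (D1 x)) (at x)) \<and>
       (\<forall>x\<in>S. (D1 has_derivative blinfun_apply (D2 x)) (at x)) \<and>
       (\<forall>x\<in>S. (D2 has_derivative blinfun_apply (D3 x)) (at x)))"

end

theory Submission
  imports Defs
begin

text \<open>
  Write \<open>h = w' - w\<close>, let \<open>p\<close>, \<open>q\<close>, \<open>t\<close> be the outputs of the networks \<open>w\<close>, \<open>w'\<close>, \<open>v\<close>, and linearise each
  neuron as \<open>relu (w'\<^sub>i \<bullet> x) - relu (w\<^sub>i \<bullet> x) = (1 + sgn (w\<^sub>i \<bullet> x)) / 2 * (h\<^sub>i \<bullet> x) + R\<^sub>i\<close>, where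
  \<open>R\<^sub>i = (\<bar>w'\<^sub>i \<bullet> x\<bar> - sgn (w\<^sub>i \<bullet> x) (w'\<^sub>i \<bullet> x)) / 2 \<ge> 0\<close>. Then \<open>F w' - F w\<close> is a linear form \<open>L h\<close> plus
  \<open>E ((p - t) \<Sum> R\<^sub>i) + E (q - p)\<^sup>2 / 2\<close>. Since \<open>A\<close> need not be convex, the segment from \<open>w\<close> to \<open>w'\<close> may pass
  through points where \<open>F\<close> is not smooth, so this remainder is estimated directly instead of by Taylor's formula.
  The key is the sharp bound \<open>E (relu (u \<bullet> x) R\<^sub>i) \<le> \<bar>u\<bar> \<bar>h\<^sub>i\<bar>\<^sup>2 / (2 \<pi> \<bar>w\<^sub>i\<bar>)\<close>. It follows from the closed form
  \<open>E (\<bar>u \<bullet> x\<bar> \<bar>w \<bullet> x\<bar>) = 2 / \<pi> (sqrt (1 - c\<^sup>2) + c arcsin c)\<close> for unit vectors with \<open>c = u \<bullet> w\<close>, from its derivative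
  in \<open>w\<close>, and from an elementary inequality between the angles of \<open>u\<close>, \<open>w\<close>, \<open>w'\<close>. A remainder quadratic in \<open>h\<close>
  for every \<open>h\<close> forces \<open>L h\<close> to be the inner product of \<open>h\<close> with the gradient.
\<close>

section \<open>Rotation invariance\<close>

lemma emeasure_lborel_ball_translate:
  fixes a b :: "'a::euclidean_space"
  shows "emeasure lborel (ball a r) = emeasure lborel (ball b r)"
proof -
  have "emeasure lborel (ball a r) = emeasure (distr lborel borel ((+) (a - b))) (ball a r)"
    by (simp add: lborel_distr_plus)
  also have "\<dots> = emeasure lborel ((+) (a - b) -` ball a r)"
    by (subst emeasure_distr) auto
  also have "(+) (a - b) -` ball a r = ball b r"
    by (auto simp: dist_norm algebra_simps)
  finally show ?thesis .
qed

text \<open>By Vitali's theorem an open set is a countable disjoint union of balls up to a null set, and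
  isometries map balls to balls.\<close>

lemma emeasure_lborel_open_le_isometry_image:
  fixes f :: "'a::euclidean_space \<Rightarrow> 'a"
  assumes f: "orthogonal_transformation f" and U: "open U"
  shows "emeasure lborel U \<le> emeasure lborel (f ` U)"
proof -
  let ?B = "\<lambda>p::'a \<times> real. ball (fst p) (snd p)"
  let ?K = "{p. 0 < snd p \<and> ?B p \<subseteq> U}"
  \<comment> \<open>The balls in \<open>?K\<close> form a Vitali cover: every point of
    \<open>U\<close> lies in arbitrarily small ones.\<close>
  have "\<exists>p. p \<in> ?K \<and> x \<in> ?B p \<and> snd p < d" if "x \<in> U" "0 < d" for x d
  proof -
    obtain e where "e > 0" "ball x e \<subseteq> U"
      using U \<open>x \<in> U\<close> open_contains_ball by blast
    then show ?thesis
      using \<open>0 < d\<close> by (intro exI[of _ "(x, min e (d/2))"]) (auto simp: ball_def)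
  qed
  then obtain C where C: "countable C" "C \<subseteq> ?K"
    "pairwise (\<lambda>i j. disjnt (?B i) (?B j)) C" "negligible (U - (\<Union>i\<in>C. ?B i))"
    using Vitali_covering_theorem_balls[of U ?K fst snd] by blast
  have "inj f" "surj f"
    using f orthogonal_transformation_inj orthogonal_transformation_surj by auto
  have nrm: "norm (f x - f y) = norm (x - y)" for x y
    using f linear_diff[of f x y] orthogonal_transformation_norm[of f "x - y"]
    by (simp add: orthogonal_transformation_linear)
  have fB: "f ` ball a r = ball (f a) r" for a r
  proof
    show "f ` ball a r \<subseteq> ball (f a) r"
      using nrm by (auto simp: dist_norm)
    show "ball (f a) r \<subseteq> f ` ball a r"
    proof
      fix y assume y: "y \<in> ball (f a) r"
      obtain x where "y = f x" using \<open>surj f\<close> by blast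
      then show "y \<in> f ` ball a r" using y nrm by (auto simp: dist_norm)
    qed
  qed
  have opn: "open (f ` U)"
  proof -
    have "open (\<Union>{ball (f a) r |a r. ball a r \<subseteq> U})" by blast
    also have "\<Union>{ball (f a) r |a r. ball a r \<subseteq> U} = f ` (\<Union>{ball a r |a r. ball a r \<subseteq> U})"
      using fB by (auto simp flip: fB)
    also have "\<Union>{ball a r |a r. ball a r \<subseteq> U} = U"
      using U by (auto simp: open_contains_ball) (metis centre_in_ball)
    finally show ?thesis .
  qed
  have null: "U - (\<Union>i\<in>C. ?B i) \<in> null_sets lborel"
  proof -
    have "U - (\<Union>i\<in>C. ?B i) \<in> sets lborel"
      using U by (intro sets.Diff) (auto intro: borel_open)
    then show ?thesis using C(4) by (simp add: negligible_iff_null_sets null_sets_completion_iff)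
  qed
  have "emeasure lborel U \<le> emeasure lborel ((\<Union>i\<in>C. ?B i) \<union> (U - (\<Union>i\<in>C. ?B i)))"
    using U by (intro emeasure_mono) (auto intro!: borel_open)
  also have "\<dots> = emeasure lborel (\<Union>i\<in>C. ?B i)"
    using null by (intro emeasure_Un_null_set) (auto intro!: borel_open)
  also have "\<dots> = (\<integral>\<^sup>+i. emeasure lborel (?B i) \<partial>count_space C)"
    using C by (intro emeasure_UN_countable)
      (auto simp: disjoint_family_on_def pairwise_def disjnt_def)
  also have "\<dots> = (\<integral>\<^sup>+i. emeasure lborel (f ` ?B i) \<partial>count_space C)"
    unfolding fB by (intro nn_integral_cong emeasure_lborel_ball_translate)
  also have "\<dots> = emeasure lborel (\<Union>i\<in>C. f ` ?B i)"
  proof (rule emeasure_UN_countable[symmetric])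
    show "disjoint_family_on (\<lambda>i. f ` ?B i) C"
      using C(3) \<open>inj f\<close> unfolding disjoint_family_on_def pairwise_def disjnt_def
      by (metis image_Int image_empty)
  qed (use C in \<open>auto simp: fB\<close>)
  also have "\<dots> \<le> emeasure lborel (f ` U)"
    using C(2) opn by (intro emeasure_mono) (auto intro!: borel_open)
  finally show ?thesis .
qed

text \<open>\<open>lborel\<close> is determined by its values on boxes, so it suffices that the
  preimage of a box has the volume of the box. The preceding inequality is used in both directions:
  for \<open>f\<close> on the preimage and for \<open>inv f\<close> on the box.\<close>

lemma lborel_distr_orthogonal:
  fixes f :: "'a::euclidean_space \<Rightarrow> 'a"
  assumes f: "orthogonal_transformation f"
  shows "distr lborel borel f = lborel"
proof (rule lborel_eqI[symmetric])
  note orthogonal_transformation_linear[OF f]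
  then have cont: "continuous_on UNIV f" and [measurable]: "f \<in> borel_measurable borel"
    using linear_continuous_on linear_conv_bounded_linear borel_measurable_continuous_onI by blast+
  fix l u :: 'a assume lu: "\<And>b. b \<in> Basis \<Longrightarrow> l \<bullet> b \<le> u \<bullet> b"
  have bij: "bij f" using f orthogonal_transformation_bij by blast
  let ?g = "inv f"
  have g: "orthogonal_transformation ?g" using f by (rule orthogonal_transformation_inv)
  have vi: "f -` box l u = ?g ` box l u" using bij by (simp add: bij_vimage_eq_inv_image)
  have op: "open (?g ` box l u)" unfolding vi[symmetric] using cont open_box open_vimage by blast
  have "f ` ?g ` box l u = box l u" using bij by (simp add: image_f_inv_f bij_is_surj)
  then have "emeasure lborel (?g ` box l u) = emeasure lborel (box l u)"
    using emeasure_lborel_open_le_isometry_image[OF f op]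
      emeasure_lborel_open_le_isometry_image[OF g open_box] by (metis antisym)
  then show "emeasure (distr lborel borel f) (box l u) = (\<Prod>b\<in>Basis. (u - l) \<bullet> b)"
    using lu by (simp add: emeasure_distr vi)
qed simp

section \<open>The standard Gaussian measure as a rotation invariant density\<close>

lemma prod_std_normal_density:
  fixes x :: "real ^ 'k::finite"
  shows "(\<Prod>i\<in>UNIV. std_normal_density (x $ i)) = (1 / sqrt (2 * pi)) ^ CARD('k) * exp (- (norm x)\<^sup>2 / 2)"
  unfolding std_normal_density_def prod.distrib power2_norm_eq_inner inner_vec_def
  by (simp add: power2_eq_square sum_negf sum_divide_distrib flip: exp_sum)

lemma sets_std_gauss [measurable_cong]: "sets std_gauss = sets borel"
  by (simp add: std_gauss_def)

lemma space_std_gauss [simp]: "space std_gauss = UNIV"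
  by (simp add: std_gauss_def)

text \<open>The density depends on \<open>x\<close> only through \<open>norm x\<close>, which
  \<open>f\<close> preserves, and \<open>lborel\<close> is invariant under \<open>f\<close>.\<close>

lemma std_gauss_distr_orthogonal:
  fixes f :: "real ^ 'k::finite \<Rightarrow> real ^ 'k"
  assumes f: "orthogonal_transformation f"
  shows "distr std_gauss borel f = std_gauss"
proof -
  let ?d = "\<lambda>x::real^'k. ennreal (\<Prod>i\<in>UNIV. std_normal_density (x $ i))"
  have [measurable]: "f \<in> borel_measurable borel"
    using orthogonal_transformation_linear[OF f]
      linear_continuous_on linear_conv_bounded_linear borel_measurable_continuous_onI by blast
  have df: "?d (f x) = ?d x" for x
    using f by (simp add: prod_std_normal_density orthogonal_transformation_norm)
  have [measurable]: "?d \<in> borel_measurable borel"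
    unfolding prod_std_normal_density by measurable
  have "density (distr lborel borel f) ?d = distr (density lborel (\<lambda>x. ?d (f x))) borel f"
    by (intro density_distr) auto
  then show ?thesis
    unfolding df lborel_distr_orthogonal[OF f] std_gauss_def by simp
qed

lemma integral_std_gauss_orthogonal:
  fixes f :: "real ^ 'k::finite \<Rightarrow> real ^ 'k" and g :: "real ^ 'k \<Rightarrow> real"
  assumes f: "orthogonal_transformation f" and [measurable]: "g \<in> borel_measurable borel"
  shows "(\<integral>x. g (f x) \<partial>std_gauss) = (\<integral>x. g x \<partial>std_gauss)"
proof -
  have [measurable]: "f \<in> borel_measurable borel"
    using orthogonal_transformation_linear[OF f]
      linear_continuous_on linear_conv_bounded_linear borel_measurable_continuous_onI by blast
  have "(\<integral>x. g x \<partial>distr std_gauss borel f) = (\<integral>x. g (f x) \<partial>std_gauss)"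
    by (rule integral_distr) measurable
  then show ?thesis using std_gauss_distr_orthogonal[OF f] by simp
qed

section \<open>Coordinates of a standard Gaussian vector\<close>

lemma borel_measurable_vec_nth [measurable]:
  "(\<lambda>x::real^'k::finite. x $ i) \<in> borel_measurable borel"
  by (intro borel_measurable_continuous_onI continuous_intros)

text \<open>Independence of the coordinates in integral form: the density is a product, so Tonelli
  over the coordinate axes factorises the integral.\<close>

lemma nn_integral_std_gauss_prod:
  fixes g :: "'k::finite \<Rightarrow> real \<Rightarrow> ennreal"
  assumes [measurable]: "\<And>i. g i \<in> borel_measurable borel"
  shows "(\<integral>\<^sup>+x. (\<Prod>i\<in>UNIV. g i (x $ i)) \<partial>std_gauss)
    = (\<Prod>i\<in>UNIV. \<integral>\<^sup>+y. g i y \<partial>density lborel std_normal_density)"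
proof -
  \<comment> \<open>\<open>idx\<close> inverts \<open>i \<mapsto> axis i 1\<close>; it translates
    products over \<open>Basis\<close>, as they arise for \<open>lborel\<close>, into products over
    coordinate indices.\<close>
  define idx where "idx b = (THE i::'k. b = axis i (1::real))" for b
  have idx: "idx (axis i 1) = i" for i
    unfolding idx_def by (rule the_equality) (auto simp: axis_eq_axis)
  have bas: "(\<Prod>b\<in>(Basis::(real^'k) set). h b) = (\<Prod>i\<in>UNIV. h (axis i 1))" for h :: "_ \<Rightarrow> ennreal"
  proof -
    have "Basis = (\<lambda>i::'k. axis i (1::real)) ` UNIV" by (auto simp: Basis_vec_def)
    moreover have "inj (\<lambda>i::'k. axis i (1::real))" by (auto simp: inj_on_def axis_eq_axis)
    ultimately show ?thesis by (metis (no_types, lifting) comp_apply prod.cong prod.reindex)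
  qed
  have "(\<integral>\<^sup>+x. (\<Prod>i\<in>UNIV. g i (x $ i)) \<partial>std_gauss)
     = (\<integral>\<^sup>+x. (\<Prod>b\<in>Basis. ennreal (std_normal_density (x \<bullet> b)) * g (idx b) (x \<bullet> b)) \<partial>lborel)"
    unfolding std_gauss_def
    by (subst nn_integral_density)
      (auto simp: bas idx inner_axis prod.distrib prod_ennreal)
  also have "\<dots> = (\<Prod>b\<in>(Basis::(real^'k) set). \<integral>\<^sup>+y. ennreal (std_normal_density y) * g (idx b) y \<partial>lborel)"
    by (intro nn_integral_lborel_prod) auto
  also have "\<dots> = (\<Prod>i\<in>UNIV. \<integral>\<^sup>+y. g i y \<partial>density lborel std_normal_density)"
    unfolding bas idx by (intro prod.cong refl) (simp add: nn_integral_density)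
  finally show ?thesis .
qed

lemma emeasure_std_normal_UNIV: "emeasure (density lborel std_normal_density) UNIV = 1"
  using prob_space.emeasure_space_1[OF prob_space_normal_density[of 1 0]] by simp

lemma distr_std_gauss_nth:
  "distr (std_gauss :: (real^'k::finite) measure) borel (\<lambda>x. x $ i) = density lborel std_normal_density"
proof (rule measure_eqI)
  fix S assume "S \<in> sets (distr (std_gauss :: (real^'k::finite) measure) borel (\<lambda>x. x $ i))"
  then have [measurable]: "S \<in> sets borel" by simp
  have "emeasure (distr (std_gauss :: (real^'k::finite) measure) borel (\<lambda>x. x $ i)) S
      = (\<integral>\<^sup>+y. indicator S y \<partial>distr (std_gauss :: (real^'k::finite) measure) borel (\<lambda>x. x $ i))"
    by simp
  also have "\<dots> = (\<integral>\<^sup>+x. indicator S (x $ i) \<partial>(std_gauss :: (real^'k::finite) measure))"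
    by (subst nn_integral_distr) measurable
  \<comment> \<open>Padding with the constant 1 in the other coordinates makes the product formula
    applicable; each padded factor integrates to total mass 1.\<close>
  also have "\<dots> = (\<integral>\<^sup>+x. (\<Prod>k\<in>UNIV. (if k = i then indicator S (x $ k) else 1)) \<partial>(std_gauss :: (real^'k::finite) measure))"
    by (simp add: prod.delta)
  also have "\<dots> = (\<Prod>k\<in>(UNIV::'k set). if k = i then emeasure (density lborel std_normal_density) S else 1)"
    by (subst nn_integral_std_gauss_prod[of "\<lambda>k y. if k = i then indicator S y else 1"])
      (measurable, intro prod.cong, auto simp: emeasure_std_normal_UNIV)
  also have "\<dots> = emeasure (density lborel std_normal_density) S"
    by (simp add: prod.delta)
  finally show "emeasure (distr (std_gauss :: (real^'k::finite) measure) borel (\<lambda>x. x $ i)) S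
    = emeasure (density lborel std_normal_density) S" .
qed simp

text \<open>It suffices to compare the measures of rectangles \<open>S \<times> T\<close>, where
  coordinates other than \<open>i\<close> and \<open>j\<close> contribute total mass 1.\<close>

lemma distr_std_gauss_nth_nth:
  fixes i j :: "'k::finite"
  assumes "i \<noteq> j"
  shows "density lborel std_normal_density \<Otimes>\<^sub>M density lborel std_normal_density
    = distr std_gauss (borel \<Otimes>\<^sub>M borel) (\<lambda>x. (x $ i, x $ j))"
proof (rule pair_measure_eqI)
  show "sigma_finite_measure (density lborel std_normal_density)"
       "sigma_finite_measure (density lborel std_normal_density)"
    using prob_space_normal_density[of 1 0] prob_space_imp_sigma_finite by auto
  show "sets (density lborel std_normal_density \<Otimes>\<^sub>M density lborel std_normal_density)
    = sets (distr std_gauss (borel \<Otimes>\<^sub>M borel) (\<lambda>x. (x $ i, x $ j)))"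
    by (simp cong: sets_pair_measure_cong)
next
  let ?N = "density lborel std_normal_density"
  fix S T :: "real set" assume "S \<in> sets ?N" "T \<in> sets ?N"
  then have [measurable]: "S \<in> sets borel" "T \<in> sets borel" by auto
  let ?g = "\<lambda>k y. if k = i then indicator S y else if k = j then indicator T y else (1::ennreal)"
  have ij: "(\<Prod>k\<in>(UNIV::'k set). if k = i then a else if k = j then b else 1) = a * (b::ennreal)" for a b
  proof -
    have "(if k = i then a else if k = j then b else 1) = (if k = i then a else 1) * (if k = j then b else 1)" for k
      using assms by simp
    then show ?thesis by (simp only: prod.distrib) (simp add: prod.delta)
  qed
  have "emeasure (distr std_gauss (borel \<Otimes>\<^sub>M borel) (\<lambda>x. (x $ i, x $ j))) (S \<times> T)
     = (\<integral>\<^sup>+p. indicator (S \<times> T) p \<partial>distr (std_gauss::(real^'k) measure) (borel \<Otimes>\<^sub>M borel) (\<lambda>x. (x $ i, x $ j)))"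
    by (subst nn_integral_indicator) auto
  also have "\<dots> = (\<integral>\<^sup>+x. indicator (S \<times> T) (x $ i, x $ j) \<partial>(std_gauss::(real^'k) measure))"
    by (subst nn_integral_distr) measurable
  also have "\<dots> = (\<integral>\<^sup>+x. indicator S (x $ i) * indicator T (x $ j) \<partial>(std_gauss::(real^'k) measure))"
    by (intro nn_integral_cong) (simp split: split_indicator)
  also have "\<dots> = (\<integral>\<^sup>+x. (\<Prod>k\<in>UNIV. ?g k (x $ k)) \<partial>(std_gauss::(real^'k) measure))"
    by (simp only: ij[symmetric])  (auto intro!: nn_integral_cong prod.cong)
  also have "\<dots> = (\<Prod>k\<in>UNIV. \<integral>\<^sup>+y. ?g k y \<partial>?N)"
    by (intro nn_integral_std_gauss_prod) auto
  also have "\<dots> = (\<Prod>k\<in>UNIV. if k = i then emeasure ?N S else if k = j then emeasure ?N T else 1)"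
    by (intro prod.cong) (auto simp: emeasure_std_normal_UNIV)
  also have "\<dots> = emeasure ?N S * emeasure ?N T" by (rule ij)
  finally show "emeasure ?N S * emeasure ?N T
    = emeasure (distr std_gauss (borel \<Otimes>\<^sub>M borel) (\<lambda>x. (x $ i, x $ j))) (S \<times> T)" by simp
qed

section \<open>The arc-sine kernel\<close>

text \<open>The substitution \<open>y = sqrt a * x\<close> leads to the third absolute moment
  \<open>2 * sqrt (2/pi)\<close> of the standard normal law. This is the inner integral that remains
  when a Gaussian integral over the plane is written in terms of the slope \<open>u = y / x\<close>,
  with \<open>a = 1 + u\<^sup>2\<close>.\<close>

lemma nn_integral_cubic_gaussian:
  fixes a :: real
  assumes "a > 0"
  shows "(\<integral>\<^sup>+x. ennreal (\<bar>x\<bar>^3 * exp (- a * x\<^sup>2 / 2) / (2 * pi)) \<partial>lborel) = ennreal (2 / (pi * a\<^sup>2))"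
proof -
  let ?I = "\<integral>\<^sup>+x. ennreal (\<bar>x\<bar>^3 * exp (- a * x\<^sup>2 / 2) / (2 * pi)) \<partial>lborel"
  have sa: "sqrt a > 0" using assms by simp
  have "ennreal (sqrt (2/pi) * 2) = (\<integral>\<^sup>+x. ennreal (std_normal_density x * \<bar>x\<bar>^3) \<partial>lborel)"
    using std_normal_moment_abs_odd[of 1]
    by (subst nn_integral_eq_integral)
      (auto simp: has_bochner_integral_iff eval_nat_numeral)
  also have "\<dots> = ennreal \<bar>sqrt a\<bar> * (\<integral>\<^sup>+x. ennreal (std_normal_density (0 + sqrt a * x) * \<bar>0 + sqrt a * x\<bar>^3) \<partial>lborel)"
    using sa by (intro nn_integral_real_affine) auto
  also have "(\<integral>\<^sup>+x. ennreal (std_normal_density (0 + sqrt a * x) * \<bar>0 + sqrt a * x\<bar>^3) \<partial>lborel)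
     = (\<integral>\<^sup>+x. ennreal (sqrt a ^ 3 * sqrt (2 * pi)) * ennreal (\<bar>x\<bar>^3 * exp (- a * x\<^sup>2 / 2) / (2 * pi)) \<partial>lborel)"
  proof (intro nn_integral_cong)
    fix x :: real
    have "1 / sqrt (2 * pi) = sqrt (2 * pi) / (2 * pi)"
      by (simp add: field_simps)
    then have "std_normal_density (0 + sqrt a * x) * \<bar>0 + sqrt a * x\<bar>^3
      = (sqrt a ^ 3 * sqrt (2 * pi)) * (\<bar>x\<bar>^3 * exp (- a * x\<^sup>2 / 2) / (2 * pi))"
      using assms unfolding std_normal_density_def
      by (simp add: abs_mult power_mult_distrib)
    then show "ennreal (std_normal_density (0 + sqrt a * x) * \<bar>0 + sqrt a * x\<bar>^3)
      = ennreal (sqrt a ^ 3 * sqrt (2 * pi)) * ennreal (\<bar>x\<bar>^3 * exp (- a * x\<^sup>2 / 2) / (2 * pi))"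
      using sa by (subst ennreal_mult''[symmetric]) auto
  qed
  also have "\<dots> = ennreal (sqrt a ^ 3 * sqrt (2 * pi)) * ?I"
    by (rule nn_integral_cmult) measurable
  also have "ennreal \<bar>sqrt a\<bar> * (ennreal (sqrt a ^ 3 * sqrt (2 * pi)) * ?I) = ennreal (a\<^sup>2 * sqrt (2 * pi)) * ?I"
  proof -
    have "\<bar>sqrt a\<bar> * (sqrt a ^ 3 * sqrt (2 * pi)) = a\<^sup>2 * sqrt (2 * pi)"
    proof -
      have "sqrt a * sqrt a ^ 3 = (sqrt a ^ 2)^2" by (simp only: power_mult[symmetric] power_Suc[symmetric]) simp
      also have "\<dots> = a\<^sup>2" using assms by simp
      finally show ?thesis using sa by (simp add: mult.assoc[symmetric])
    qed
    then show ?thesis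
      using ennreal_mult'[of "\<bar>sqrt a\<bar>" "sqrt a ^ 3 * sqrt (2 * pi)"]
      by (simp only: mult.assoc[symmetric] abs_ge_zero)
  qed
  finally have eq: "ennreal (sqrt (2/pi) * 2) = ennreal (a\<^sup>2 * sqrt (2 * pi)) * ?I" .
  \<comment> \<open>In \<open>ennreal\<close> the factor is removed by multiplying with its finite
    reciprocal, which does not presuppose that \<open>?I\<close> is finite.\<close>
  have "ennreal (1 / (a\<^sup>2 * sqrt (2 * pi))) * ennreal (sqrt (2/pi) * 2) = ?I"
    unfolding eq mult.assoc[symmetric] using assms
    by (subst ennreal_mult''[symmetric]) auto
  moreover have "1 / (a\<^sup>2 * sqrt (2 * pi)) * (sqrt (2/pi) * 2) = 2 / (pi * a\<^sup>2)"
    using assms by (simp add: real_sqrt_divide real_sqrt_mult field_simps)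
  ultimately show ?thesis
    using ennreal_mult''[of "sqrt (2/pi) * 2" "1 / (a\<^sup>2 * sqrt (2 * pi))"] by simp
qed

text \<open>Half of the slope integral. The integrand is nonnegative exactly from
  \<open>-c/s\<close> on, so the fundamental theorem applies with an explicit antiderivative, whose
  value at the end point becomes an arcsine.\<close>

lemma nn_integral_half_line_kernel:
  fixes c s :: real
  assumes "c\<^sup>2 + s\<^sup>2 = 1" "s > 0"
  shows "(\<integral>\<^sup>+u. ennreal ((c + s * u) / (1 + u\<^sup>2)\<^sup>2) * indicator {-c/s..} u \<partial>lborel)
    = ennreal (c * pi / 4 + (s + c * arcsin c) / 2)"
proof -
  \<comment> \<open>\<open>u / (1 + u\<^sup>2) + arctan u\<close> is an antiderivative of
    \<open>2 / (1 + u\<^sup>2)\<^sup>2\<close>; the last term accounts for the part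
    \<open>s * u / (1 + u\<^sup>2)\<^sup>2\<close>.\<close>
  let ?F = "\<lambda>u::real. c / 2 * (u / (1 + u\<^sup>2) + arctan u) - s / (2 * (1 + u\<^sup>2))"
  have pos: "1 + u\<^sup>2 > 0" for u :: real
    by (simp add: add_pos_nonneg)
  have "(\<integral>\<^sup>+u. ennreal ((c + s * u) / (1 + u\<^sup>2)\<^sup>2) * indicator {-c/s..} u \<partial>lborel)
    = ennreal (c / 2 * (0 + pi / 2) - 0 - ?F (-c/s))"
  proof (rule nn_integral_FTC_atLeast)
    show "(\<lambda>u. (c + s * u) / (1 + u\<^sup>2)\<^sup>2) \<in> borel_measurable borel" by measurable
    fix u :: real
    have nz: "1 + u\<^sup>2 \<noteq> 0" using pos[of u] by simp
    have "(1 * (1 + u\<^sup>2) - u * (2 * u)) / (1 + u\<^sup>2)\<^sup>2 + 1 / (1 + u\<^sup>2) = 2 / (1 + u\<^sup>2)\<^sup>2"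
      using nz by (simp add: divide_simps) (simp add: power2_eq_square algebra_simps)
    moreover have "((\<lambda>u. u / (1 + u\<^sup>2) + arctan u) has_real_derivative
        ((1 * (1 + u\<^sup>2) - u * (2 * u)) / (1 + u\<^sup>2)\<^sup>2 + 1 / (1 + u\<^sup>2))) (at u)"
      using nz by (auto intro!: derivative_eq_intros simp: power2_eq_square inverse_eq_divide)
    ultimately have d1: "((\<lambda>u. u / (1 + u\<^sup>2) + arctan u) has_real_derivative 2 / (1 + u\<^sup>2)\<^sup>2) (at u)"
      by simp
    have d2: "((\<lambda>u. s / (2 * (1 + u\<^sup>2))) has_real_derivative - (s * u) / (1 + u\<^sup>2)\<^sup>2) (at u)"
    proof -
      have "((\<lambda>u. s / 2 * inverse (1 + u\<^sup>2)) has_real_derivative s / 2 * (- (inverse (1 + u\<^sup>2) * (2 * u) * inverse (1 + u\<^sup>2)))) (at u)"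
        using nz by (auto intro!: derivative_eq_intros)
      moreover have "s / 2 * (- (inverse y * (2 * u) * inverse y)) = - (s * u) / y\<^sup>2" for y
        by (cases "y = 0") (simp_all add: field_simps power2_eq_square)
      moreover have "s / (2 * y) = s / 2 * inverse y" for y by (simp add: inverse_eq_divide)
      ultimately show ?thesis by (simp only:)
    qed
    show "(?F has_real_derivative (c + s * u) / (1 + u\<^sup>2)\<^sup>2) (at u)"
      using DERIV_diff[OF DERIV_cmult[OF d1, of "c/2"] d2] by (simp add: add_divide_distrib)
    assume "-c/s \<le> u"
    then have "0 \<le> c + s * u" using assms(2) by (simp add: field_simps)
    then show "0 \<le> (c + s * u) / (1 + u\<^sup>2)\<^sup>2" by simp
  next
    have i: "((\<lambda>u. k * inverse u) \<longlongrightarrow> 0) at_top" for k :: real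
      using tendsto_mult[OF tendsto_const tendsto_inverse_0_at_top[OF filterlim_ident]] by simp
    have "\<forall>\<^sub>F u::real in at_top. norm (u / (1 + u\<^sup>2)) \<le> 1 * inverse u"
      using eventually_gt_at_top[of 0]
      by eventually_elim (use pos in \<open>simp add: field_simps power2_eq_square\<close>)
    from Lim_null_comparison[OF this i] have l1: "((\<lambda>u::real. u / (1 + u\<^sup>2)) \<longlongrightarrow> 0) at_top" .
    have "\<forall>\<^sub>F u::real in at_top. norm (s / (2 * (1 + u\<^sup>2))) \<le> s * inverse u"
      using eventually_gt_at_top[of 0]
    proof eventually_elim
      case (elim u)
      have "u \<le> 2 * (1 + u\<^sup>2)" using zero_le_power2[of "u - 1"] zero_le_power2[of u] elim
        unfolding power2_diff by simp
      then have "s * u \<le> s * (2 * (1 + u\<^sup>2))" using assms(2) by simp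
      then show ?case using elim pos[of u] assms(2) by (simp add: field_simps)
    qed
    from Lim_null_comparison[OF this i] have l2: "((\<lambda>u::real. s / (2 * (1 + u\<^sup>2))) \<longlongrightarrow> 0) at_top" .
    show "(?F \<longlongrightarrow> c / 2 * (0 + pi / 2) - 0) at_top"
      by (intro tendsto_intros l1 l2 tendsto_arctan_at_top)
  qed
  also have "c / 2 * (0 + pi / 2) - 0 - ?F (-c/s) = c * pi / 4 + (s + c * arcsin c) / 2"
  proof -
    have c: "-1 < c" "c < 1"
    proof -
      have "c\<^sup>2 < 1" using assms by (smt (verit) zero_less_power2)
      then show "-1 < c" "c < 1" by (auto simp: abs_square_less_1)
    qed
    have s: "sqrt (1 - c\<^sup>2) = s" using assms by (simp add: real_sqrt_unique)
    \<comment> \<open>With \<open>c\<close> a sine and \<open>s\<close> the matching cosine,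
      \<open>c / s\<close> is the tangent of \<open>arcsin c\<close>.\<close>
    have at: "arctan (-c/s) = - arcsin c"
      using arcsin_arctan[of c] c s by (simp add: arctan_minus)
    have q: "1 + (-c/s)\<^sup>2 = 1 / s\<^sup>2"
      using assms by (simp add: power_divide field_simps)
    have "c\<^sup>2 * s + s ^ 3 = s"
      using assms(1) by (metis add.commute distrib_right mult_1 power2_eq_square power3_eq_cube)
    then show ?thesis
      unfolding at q using assms(2)
      by (simp add: field_simps power2_eq_square power3_eq_cube)
  qed
  finally show ?thesis .
qed

text \<open>With \<open>\<theta> = arccos (- c)\<close> the expression is
  \<open>(sin \<theta> - \<theta> * cos \<theta>) / 2\<close>, which vanishes at 0 and has
  derivative \<open>\<theta> * sin \<theta> / 2\<close>. The sign matters because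
  \<open>ennreal\<close> cuts negative reals off at 0, so two half-line values are merged into one
  \<open>ennreal\<close> only once both are known to be nonnegative.\<close>

lemma half_line_kernel_nonneg:
  fixes c s :: real
  assumes cs: "c\<^sup>2 + s\<^sup>2 = 1" and s: "s > 0"
  shows "0 \<le> c * pi / 4 + (s + c * arcsin c) / 2"
proof -
  define \<theta> where "\<theta> = arccos (- c)"
  have "c\<^sup>2 \<le> 1" using cs by (smt (verit) zero_le_power2)
  then have c: "-1 \<le> c" "c \<le> 1" by (auto simp: abs_square_le_1)
  have \<theta>: "0 \<le> \<theta>" "\<theta> \<le> pi" "cos \<theta> = - c"
    unfolding \<theta>_def using c by (auto intro: arccos_lbound arccos_ubound)
  have "sin \<theta> = sqrt (1 - c\<^sup>2)"
    unfolding \<theta>_def using c sin_arccos[of "-c"] by simp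
  then have sin: "sin \<theta> = s" using cs s by (simp add: real_sqrt_unique)
  have as: "arcsin c = \<theta> - pi / 2"
    unfolding \<theta>_def using c by (simp add: arccos_minus arcsin_arccos_eq)
  have "sin 0 - 0 * cos 0 \<le> sin \<theta> - \<theta> * cos \<theta>"
  proof (rule DERIV_nonneg_imp_nondecreasing[OF \<theta>(1)])
    fix x assume x: "0 \<le> x" "x \<le> \<theta>"
    have "((\<lambda>x. sin x - x * cos x) has_real_derivative x * sin x) (at x)"
      by (auto intro!: derivative_eq_intros)
    moreover have "0 \<le> x * sin x" using x \<theta>(2) by (intro mult_nonneg_nonneg sin_ge_zero) auto
    ultimately show "\<exists>y. ((\<lambda>x. sin x - x * cos x) has_real_derivative y) (at x) \<and> 0 \<le> y" by blast
  qed
  then show ?thesis unfolding as sin \<theta>(3) by (simp add: field_simps)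
qed

text \<open>Tonelli and the substitution \<open>y = x * u\<close> in the inner integral: the
  densities contribute \<open>exp (- (1 + u\<^sup>2) * x\<^sup>2 / 2)\<close>, and after exchanging
  the integrals \<open>x\<close> is integrated out. Up to the factor \<open>2 / pi\<close> this
  leaves \<open>\<bar>c + s * u\<bar> / (1 + u\<^sup>2)\<^sup>2\<close> to be integrated over all
  slopes \<open>u\<close>.\<close>

lemma nn_integral_pair_std_normal_abs:
  fixes c s :: real
  assumes cs: "c\<^sup>2 + s\<^sup>2 = 1" and s: "s > 0"
  shows "(\<integral>\<^sup>+p. ennreal (\<bar>fst p\<bar> * \<bar>c * fst p + s * snd p\<bar>)
      \<partial>(density lborel std_normal_density \<Otimes>\<^sub>M density lborel std_normal_density))
    = ennreal (2 / pi * (s + c * arcsin c))"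
proof -
  let ?N = "density lborel std_normal_density"
  let ?\<phi> = std_normal_density
  interpret N: prob_space ?N using prob_space_normal_density[of 1 0] by simp
  have "(\<integral>\<^sup>+p. ennreal (\<bar>fst p\<bar> * \<bar>c * fst p + s * snd p\<bar>) \<partial>(?N \<Otimes>\<^sub>M ?N))
    = (\<integral>\<^sup>+x. \<integral>\<^sup>+y. ennreal (\<bar>x\<bar> * \<bar>c * x + s * y\<bar>) \<partial>?N \<partial>?N)"
    by (subst N.nn_integral_fst[symmetric]) auto
  also have "\<dots> = (\<integral>\<^sup>+x. ennreal (?\<phi> x) * (\<integral>\<^sup>+y. ennreal (?\<phi> y * (\<bar>x\<bar> * \<bar>c * x + s * y\<bar>)) \<partial>lborel) \<partial>lborel)"
    by (simp add: nn_integral_density ennreal_mult')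
  also have "\<dots> = (\<integral>\<^sup>+x. (\<integral>\<^sup>+u. ennreal (\<bar>c + s * u\<bar>) * ennreal (\<bar>x\<bar>^3 * exp (- (1 + u\<^sup>2) * x\<^sup>2 / 2) / (2 * pi)) \<partial>lborel) \<partial>lborel)"
  proof (rule nn_integral_cong_AE)
    \<comment> \<open>Scaling the inner variable by \<open>x\<close> requires
      \<open>x \<noteq> 0\<close>.\<close>
    have ae: "AE x in lborel. x \<noteq> (0::real)" by (rule AE_lborel_singleton)
    show "AE x in lborel. ennreal (?\<phi> x) * (\<integral>\<^sup>+y. ennreal (?\<phi> y * (\<bar>x\<bar> * \<bar>c * x + s * y\<bar>)) \<partial>lborel)
      = (\<integral>\<^sup>+u. ennreal (\<bar>c + s * u\<bar>) * ennreal (\<bar>x\<bar>^3 * exp (- (1 + u\<^sup>2) * x\<^sup>2 / 2) / (2 * pi)) \<partial>lborel)"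
      using ae
    proof eventually_elim
      case (elim x)
      have "(\<integral>\<^sup>+y. ennreal (?\<phi> y * (\<bar>x\<bar> * \<bar>c * x + s * y\<bar>)) \<partial>lborel)
        = ennreal \<bar>x\<bar> * (\<integral>\<^sup>+u. ennreal (?\<phi> (0 + x * u) * (\<bar>x\<bar> * \<bar>c * x + s * (0 + x * u)\<bar>)) \<partial>lborel)"
        using elim by (intro nn_integral_real_affine) auto
      then have "ennreal (?\<phi> x) * (\<integral>\<^sup>+y. ennreal (?\<phi> y * (\<bar>x\<bar> * \<bar>c * x + s * y\<bar>)) \<partial>lborel)
        = ennreal (?\<phi> x * \<bar>x\<bar>) * (\<integral>\<^sup>+u. ennreal (?\<phi> (0 + x * u) * (\<bar>x\<bar> * \<bar>c * x + s * (0 + x * u)\<bar>)) \<partial>lborel)"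
        by (simp add: ennreal_mult mult.assoc)
      also have "\<dots> = (\<integral>\<^sup>+u. ennreal (?\<phi> x * \<bar>x\<bar>) * ennreal (?\<phi> (0 + x * u) * (\<bar>x\<bar> * \<bar>c * x + s * (0 + x * u)\<bar>)) \<partial>lborel)"
        by (intro nn_integral_cmult[symmetric]) auto
      also have "\<dots> = (\<integral>\<^sup>+u. ennreal (\<bar>c + s * u\<bar>) * ennreal (\<bar>x\<bar>^3 * exp (- (1 + u\<^sup>2) * x\<^sup>2 / 2) / (2 * pi)) \<partial>lborel)"
      proof (intro nn_integral_cong)
        fix u :: real
        have "?\<phi> x * ?\<phi> (x * u) = exp (- (1 + u\<^sup>2) * x\<^sup>2 / 2) / (2 * pi)"
        proof -
          have "exp (- x\<^sup>2 / 2) * exp (- (x * u)\<^sup>2 / 2) = exp (- (1 + u\<^sup>2) * x\<^sup>2 / 2)"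
            unfolding exp_add[symmetric] by (simp add: power_mult_distrib field_simps)
          moreover have "1 / sqrt (2 * pi) * (1 / sqrt (2 * pi)) = 1 / (2 * pi)" by simp
          moreover have "?\<phi> x * ?\<phi> (x * u)
              = (1 / sqrt (2 * pi) * (1 / sqrt (2 * pi))) * (exp (- x\<^sup>2 / 2) * exp (- (x * u)\<^sup>2 / 2))"
            unfolding std_normal_density_def by (simp only: mult_ac)
          ultimately show ?thesis by simp
        qed
        moreover have "\<bar>x\<bar> * \<bar>c * x + s * (0 + x * u)\<bar> = \<bar>x\<bar>\<^sup>2 * \<bar>c + s * u\<bar>"
        proof -
          have "c * x + s * (0 + x * u) = x * (c + s * u)" by (simp add: algebra_simps)
          then show ?thesis by (simp add: abs_mult power2_eq_square)
        qed
        ultimately have "?\<phi> x * \<bar>x\<bar> * (?\<phi> (0 + x * u) * (\<bar>x\<bar> * \<bar>c * x + s * (0 + x * u)\<bar>))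
          = \<bar>c + s * u\<bar> * (\<bar>x\<bar>^3 * exp (- (1 + u\<^sup>2) * x\<^sup>2 / 2) / (2 * pi))"
          by (simp add: power2_eq_square power3_eq_cube mult_ac flip: times_divide_eq_right)
        then show "ennreal (?\<phi> x * \<bar>x\<bar>) * ennreal (?\<phi> (0 + x * u) * (\<bar>x\<bar> * \<bar>c * x + s * (0 + x * u)\<bar>))
          = ennreal (\<bar>c + s * u\<bar>) * ennreal (\<bar>x\<bar>^3 * exp (- (1 + u\<^sup>2) * x\<^sup>2 / 2) / (2 * pi))"
          by (subst (1 2) ennreal_mult'[symmetric]) auto
      qed
      finally show ?case .
    qed
  qed
  also have "\<dots> = (\<integral>\<^sup>+u. (\<integral>\<^sup>+x. ennreal (\<bar>c + s * u\<bar>) * ennreal (\<bar>x\<bar>^3 * exp (- (1 + u\<^sup>2) * x\<^sup>2 / 2) / (2 * pi)) \<partial>lborel) \<partial>lborel)"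
    by (rule lborel_pair.Fubini') measurable
  also have "\<dots> = (\<integral>\<^sup>+u. ennreal (2 / pi) * ennreal (\<bar>c + s * u\<bar> / (1 + u\<^sup>2)\<^sup>2) \<partial>lborel)"
  proof (intro nn_integral_cong)
    fix u :: real
    have p: "1 + u\<^sup>2 > 0" by (simp add: add_pos_nonneg)
    have "(\<integral>\<^sup>+x. ennreal (\<bar>c + s * u\<bar>) * ennreal (\<bar>x\<bar>^3 * exp (- (1 + u\<^sup>2) * x\<^sup>2 / 2) / (2 * pi)) \<partial>lborel)
      = ennreal (\<bar>c + s * u\<bar>) * (\<integral>\<^sup>+x. ennreal (\<bar>x\<bar>^3 * exp (- (1 + u\<^sup>2) * x\<^sup>2 / 2) / (2 * pi)) \<partial>lborel)"
      by (intro nn_integral_cmult) auto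
    also have "\<dots> = ennreal (\<bar>c + s * u\<bar>) * ennreal (2 / (pi * (1 + u\<^sup>2)\<^sup>2))"
      using nn_integral_cubic_gaussian[OF p] by simp
    also have "\<dots> = ennreal (2 / pi) * ennreal (\<bar>c + s * u\<bar> / (1 + u\<^sup>2)\<^sup>2)"
      by (subst (1 2) ennreal_mult'[symmetric]) (auto simp: mult_ac)
    finally show "(\<integral>\<^sup>+x. ennreal (\<bar>c + s * u\<bar>) * ennreal (\<bar>x\<bar>^3 * exp (- (1 + u\<^sup>2) * x\<^sup>2 / 2) / (2 * pi)) \<partial>lborel)
      = ennreal (2 / pi) * ennreal (\<bar>c + s * u\<bar> / (1 + u\<^sup>2)\<^sup>2)" .
  qed
  also have "\<dots> = ennreal (2 / pi) * (\<integral>\<^sup>+u. ennreal (\<bar>c + s * u\<bar> / (1 + u\<^sup>2)\<^sup>2) \<partial>lborel)"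
    by (intro nn_integral_cmult) auto
  \<comment> \<open>The end point \<open>-c/s\<close> belongs to both half-lines; nothing is counted
    twice since the integrand vanishes there.\<close>
  also have "(\<integral>\<^sup>+u. ennreal (\<bar>c + s * u\<bar> / (1 + u\<^sup>2)\<^sup>2) \<partial>lborel)
    = (\<integral>\<^sup>+u. ennreal ((c + s * u) / (1 + u\<^sup>2)\<^sup>2) * indicator {-c/s..} u
        + ennreal ((- c - s * u) / (1 + u\<^sup>2)\<^sup>2) * indicator {..-c/s} u \<partial>lborel)"
  proof (intro nn_integral_cong)
    fix u :: real
    have iff: "-c/s \<le> u \<longleftrightarrow> 0 \<le> c + s * u" "u \<le> -c/s \<longleftrightarrow> c + s * u \<le> 0"
      using s by (auto simp: field_simps)
    show "ennreal (\<bar>c + s * u\<bar> / (1 + u\<^sup>2)\<^sup>2) = ennreal ((c + s * u) / (1 + u\<^sup>2)\<^sup>2) * indicator {-c/s..} u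
        + ennreal ((- c - s * u) / (1 + u\<^sup>2)\<^sup>2) * indicator {..-c/s} u"
    proof (cases "c + s * u" "0::real" rule: linorder_cases)
      case equal
      then have "- c - s * u = 0" by simp
      then show ?thesis using equal by simp
    next
      case less
      then have "\<bar>c + s * u\<bar> = - c - s * u" by simp
      then show ?thesis using less iff by (simp add: indicator_def)
    next
      case greater
      then show ?thesis using iff by (simp add: indicator_def)
    qed
  qed
  also have "\<dots> = (\<integral>\<^sup>+u. ennreal ((c + s * u) / (1 + u\<^sup>2)\<^sup>2) * indicator {-c/s..} u \<partial>lborel)
        + (\<integral>\<^sup>+u. ennreal ((- c - s * u) / (1 + u\<^sup>2)\<^sup>2) * indicator {..-c/s} u \<partial>lborel)"
    by (intro nn_integral_add) auto
  \<comment> \<open>The reflection \<open>u \<mapsto> - u\<close> turns the negative half into the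
    positive half for \<open>- c\<close>.\<close>
  also have "(\<integral>\<^sup>+u. ennreal ((- c - s * u) / (1 + u\<^sup>2)\<^sup>2) * indicator {..-c/s} u \<partial>lborel)
     = ennreal \<bar>-1\<bar> * (\<integral>\<^sup>+u. ennreal ((- c - s * (0 + (-1) * u)) / (1 + (0 + (-1) * u)\<^sup>2)\<^sup>2) * indicator {..-c/s} (0 + (-1) * u) \<partial>lborel)"
    by (rule nn_integral_real_affine) auto
  also have "\<dots> = (\<integral>\<^sup>+u. ennreal ((- c + s * u) / (1 + u\<^sup>2)\<^sup>2) * indicator {-(-c)/s..} u \<partial>lborel)"
  proof -
    have "indicator {..-c/s} (0 + (-1) * u) = (indicator {-(-c)/s..} u :: ennreal)" for u
      by (auto simp: indicator_def)
    then show ?thesis by simp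
  qed
  also have "(\<integral>\<^sup>+u. ennreal ((c + s * u) / (1 + u\<^sup>2)\<^sup>2) * indicator {-c/s..} u \<partial>lborel)
      + (\<integral>\<^sup>+u. ennreal ((- c + s * u) / (1 + u\<^sup>2)\<^sup>2) * indicator {-(-c)/s..} u \<partial>lborel)
    = ennreal (c * pi / 4 + (s + c * arcsin c) / 2) + ennreal (- c * pi / 4 + (s + - c * arcsin (- c)) / 2)"
    using nn_integral_half_line_kernel[of c s] nn_integral_half_line_kernel[of "-c" s] cs s by simp
  also have "\<dots> = ennreal (s + c * arcsin c)"
  proof -
    have c: "-1 \<le> c" "c \<le> 1"
    proof -
      have "c\<^sup>2 \<le> 1" using cs by (smt (verit) zero_le_power2)
      then show "-1 \<le> c" "c \<le> 1" by (auto simp: abs_square_le_1)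
    qed
    have "0 \<le> c * pi / 4 + (s + c * arcsin c) / 2" "0 \<le> - c * pi / 4 + (s + - c * arcsin (- c)) / 2"
      using half_line_kernel_nonneg[of c s] half_line_kernel_nonneg[of "-c" s] cs s by auto
    then show ?thesis
      using arcsin_minus[OF c] by (subst ennreal_plus[symmetric]) (auto simp: field_simps)
  qed
  finally show ?thesis
    by (subst ennreal_mult') simp_all
qed

text \<open>The Householder reflection in the hyperplane orthogonal to \<open>a - b\<close>.\<close>

lemma exists_orthogonal_transformation_reflection:
  fixes a b :: "'a::euclidean_space"
  assumes "norm a = norm b"
  obtains T where "orthogonal_transformation T" "T a = b" "\<And>y. y \<bullet> (a - b) = 0 \<Longrightarrow> T y = y"
proof
  define n where "n = a - b"
  let ?T = "\<lambda>x. x - (2 * (x \<bullet> n) / (n \<bullet> n)) *\<^sub>R n"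
  have "linear ?T"
    by (rule linearI) (auto simp: inner_add_left algebra_simps add_divide_distrib)
  moreover have "?T x \<bullet> ?T y = x \<bullet> y" for x y
    by (cases "n = 0") (auto simp: inner_diff_left inner_diff_right inner_commute field_simps)
  ultimately show "orthogonal_transformation ?T"
    by (simp add: orthogonal_transformation_def)
  have "a \<bullet> a = b \<bullet> b" using assms by (simp add: norm_eq)
  then have "n \<bullet> n = 2 * (a \<bullet> n)"
    by (simp add: n_def inner_diff_left inner_diff_right inner_commute)
  then have "2 * (a \<bullet> n) / (n \<bullet> n) = 1" if "n \<noteq> 0"
    using that by (metis divide_self inner_eq_zero_iff)
  then have "(2 * (a \<bullet> n) / (n \<bullet> n)) *\<^sub>R n = n"
    by (cases "n = 0") auto
  then show "?T a = b" by (simp add: n_def)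
  show "?T y = y" if "y \<bullet> (a - b) = 0" for y
    using that by (simp add: n_def)
qed

section \<open>Second moments of linear forms and the closed form of the kernel\<close>

lemma borel_measurable_inner_left [measurable]:
  "(\<lambda>x::real^'k::finite. a \<bullet> x) \<in> borel_measurable borel"
  by (intro borel_measurable_continuous_onI continuous_intros)

text \<open>Rotate \<open>w\<close> to \<open>norm w\<close> times a coordinate vector; what remains
  is the variance 1 of one standard normal coordinate.\<close>

lemma has_bochner_integral_std_gauss_inner_sq:
  fixes w :: "real ^ 'k::finite"
  shows "has_bochner_integral std_gauss (\<lambda>x. (w \<bullet> x)\<^sup>2) ((norm w)\<^sup>2)"
proof -
  fix i :: 'k
  have "norm w = norm (norm w *\<^sub>R (axis i 1 :: real^'k))" by (simp add: norm_axis_1)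
  then obtain T :: "real^'k \<Rightarrow> real^'k" where T: "orthogonal_transformation T" "T w = norm w *\<^sub>R axis i 1"
    by (rule exists_orthogonal_transformation_reflection) auto
  have [measurable]: "T \<in> borel_measurable borel"
    using orthogonal_transformation_linear[OF T(1)]
      linear_continuous_on linear_conv_bounded_linear borel_measurable_continuous_onI by blast
  have wx: "(w \<bullet> x)\<^sup>2 = (norm w)\<^sup>2 * (T x $ i)\<^sup>2" for x
  proof -
    have "w \<bullet> x = T w \<bullet> T x" using T(1) by (simp add: orthogonal_transformation_def)
    also have "\<dots> = norm w * (T x $ i)" by (simp add: T(2) inner_axis')
    finally show ?thesis by (simp add: power_mult_distrib)
  qed
  have N: "has_bochner_integral (density lborel std_normal_density) (\<lambda>y::real. y\<^sup>2) 1"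
    using std_normal_moment_even[of 1]
    by (subst has_bochner_integral_density) (auto simp: fact_numeral)
  have "has_bochner_integral (distr (std_gauss :: (real^'k) measure) borel (\<lambda>x. x $ i)) (\<lambda>y::real. y\<^sup>2) 1"
    unfolding distr_std_gauss_nth by (rule N)
  then have "has_bochner_integral (std_gauss :: (real^'k) measure) (\<lambda>x. (x $ i)\<^sup>2) 1"
    by (auto simp: has_bochner_integral_iff integrable_distr_eq integral_distr)
  then have "has_bochner_integral (distr std_gauss borel T) (\<lambda>x. (x $ i)\<^sup>2) 1"
    by (simp add: std_gauss_distr_orthogonal[OF T(1)])
  then have "has_bochner_integral std_gauss (\<lambda>x. (T x $ i)\<^sup>2) 1"
    by (auto simp: has_bochner_integral_iff integrable_distr_eq integral_distr)
  from has_bochner_integral_mult_right[OF this, of "(norm w)\<^sup>2"]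
  show ?thesis unfolding wx by simp
qed

lemmas integrable_std_gauss_inner_sq = has_bochner_integral_std_gauss_inner_sq[THEN integrable.intros]

lemmas integral_std_gauss_inner_sq = has_bochner_integral_std_gauss_inner_sq[THEN has_bochner_integral_integral_eq]

lemma integrable_std_gauss_inner_bound:
  fixes a b :: "real ^ 'k::finite" and f :: "real ^ 'k \<Rightarrow> real"
  assumes [measurable]: "f \<in> borel_measurable borel"
    and f: "\<And>x. \<bar>f x\<bar> \<le> \<bar>a \<bullet> x\<bar> * \<bar>b \<bullet> x\<bar>"
  shows "integrable std_gauss f"
proof (rule Bochner_Integration.integrable_bound)
  show "integrable std_gauss (\<lambda>x. (a \<bullet> x)\<^sup>2 + (b \<bullet> x)\<^sup>2)"
    by (intro Bochner_Integration.integrable_add integrable_std_gauss_inner_sq)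
  show "AE x in std_gauss. norm (f x) \<le> norm ((a \<bullet> x)\<^sup>2 + (b \<bullet> x)\<^sup>2)"
  proof (rule AE_I2)
    fix x
    have "2 * \<bar>a \<bullet> x\<bar> * \<bar>b \<bullet> x\<bar> \<le> (a \<bullet> x)\<^sup>2 + (b \<bullet> x)\<^sup>2"
      using sum_squares_bound[of "\<bar>a \<bullet> x\<bar>" "\<bar>b \<bullet> x\<bar>"] by simp
    then show "norm (f x) \<le> norm ((a \<bullet> x)\<^sup>2 + (b \<bullet> x)\<^sup>2)"
      using f[of x] mult_nonneg_nonneg[of "\<bar>a \<bullet> x\<bar>" "\<bar>b \<bullet> x\<bar>"] by simp
  qed
qed measurable

text \<open>Polarisation of the second moment.\<close>

lemma integral_std_gauss_inner_mult:
  fixes a b :: "real ^ 'k::finite"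
  shows "(\<integral>x. (a \<bullet> x) * (b \<bullet> x) \<partial>std_gauss) = a \<bullet> b"
proof -
  have "(a \<bullet> x) * (b \<bullet> x) = (((a + b) \<bullet> x)\<^sup>2 - ((a - b) \<bullet> x)\<^sup>2) / 4" for x
    by (simp add: inner_add_left inner_diff_left power2_eq_square algebra_simps)
  then have "(\<integral>x. (a \<bullet> x) * (b \<bullet> x) \<partial>std_gauss) = ((norm (a + b))\<^sup>2 - (norm (a - b))\<^sup>2) / 4"
    by (simp only: integral_divide_zero Bochner_Integration.integral_diff
        integrable_std_gauss_inner_sq integral_std_gauss_inner_sq)
  also have "\<dots> = a \<bullet> b"
    by (simp add: power2_norm_eq_inner inner_add_left inner_diff_left inner_add_right inner_diff_right inner_commute)
  finally show ?thesis .
qed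

text \<open>After a rotation only two coordinates matter: \<open>v\<close> becomes the
  \<open>i\<close>-th axis and \<open>w\<close> becomes \<open>c\<close> times this axis plus
  \<open>s\<close> times the \<open>j\<close>-th, where \<open>s\<close> is the norm of the part of
  \<open>w\<close> orthogonal to \<open>v\<close>. Parallel vectors are treated apart, since they
  provide no second direction.\<close>

lemma integral_std_gauss_abs_abs_unit:
  fixes v w :: "real ^ 'k::finite"
  assumes v: "norm v = 1" and w: "norm w = 1"
  shows "(\<integral>x. \<bar>v \<bullet> x\<bar> * \<bar>w \<bullet> x\<bar> \<partial>std_gauss)
    = 2 / pi * (sqrt (1 - (v \<bullet> w)\<^sup>2) + (v \<bullet> w) * arcsin (v \<bullet> w))"
proof -
  define c where "c = v \<bullet> w"
  define r where "r = w - c *\<^sub>R v"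
  have vv: "v \<bullet> v = 1" and ww: "w \<bullet> w = 1" using v w by (auto simp: norm_eq_1)
  have rr: "r \<bullet> r = 1 - c\<^sup>2" and vr: "v \<bullet> r = 0"
    unfolding r_def by (auto simp: inner_diff_left inner_diff_right vv ww c_def inner_commute power2_eq_square)
  have c1: "\<bar>c\<bar> \<le> 1" using Cauchy_Schwarz_ineq2[of v w] v w by (simp add: c_def)
  show ?thesis
  proof (cases "r = 0")
    case True
    then have wv: "w = c *\<^sub>R v" and "c\<^sup>2 = 1" using rr by (auto simp: r_def)
    then have c: "\<bar>c\<bar> = 1" by (auto simp: power2_eq_1_iff)
    have "\<bar>v \<bullet> x\<bar> * \<bar>w \<bullet> x\<bar> = (v \<bullet> x)\<^sup>2" for x
      unfolding wv using c by (simp add: abs_mult power2_eq_square)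
    then have "(\<integral>x. \<bar>v \<bullet> x\<bar> * \<bar>w \<bullet> x\<bar> \<partial>std_gauss) = 1"
      using has_bochner_integral_std_gauss_inner_sq[of v] v by (simp add: has_bochner_integral_iff)
    moreover have "c * arcsin c = pi / 2" using c by (auto simp: abs_if split: if_splits)
    ultimately show ?thesis unfolding c_def[symmetric] \<open>c\<^sup>2 = 1\<close> by simp
  next
    case False
    define s where "s = norm r"
    have s: "s > 0" "c\<^sup>2 + s\<^sup>2 = 1" "sqrt (1 - c\<^sup>2) = s"
      using False rr by (simp add: s_def, simp add: s_def power2_norm_eq_inner, simp add: s_def norm_eq_sqrt_inner)
    fix i :: 'k
    have "norm v = norm (axis i 1 :: real^'k)" using v by (simp add: norm_axis_1)
    then obtain T1 :: "real^'k \<Rightarrow> real^'k" where T1: "orthogonal_transformation T1" "T1 v = axis i 1"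
      by (rule exists_orthogonal_transformation_reflection) auto
    have "T1 r $ i = axis i 1 \<bullet> T1 r" by (simp add: inner_axis')
    also have "\<dots> = 0" using T1 vr by (simp add: orthogonal_transformation_def flip: T1(2))
    finally have T1ri: "T1 r $ i = 0" .
    \<comment> \<open>The second index comes from here: \<open>T1 r\<close> is nonzero although its
      \<open>i\<close>-th entry is 0.\<close>
    have "T1 r \<noteq> 0" using T1(1) False by (metis norm_eq_zero orthogonal_transformation_norm)
    then obtain j where "T1 r $ j \<noteq> 0" by (metis vec_eq_iff zero_index)
    with T1ri have ij: "i \<noteq> j" by auto
    \<comment> \<open>The normal of the second mirror is orthogonal to \<open>axis i 1\<close>, so
      \<open>T2\<close> keeps the image of \<open>v\<close> already reached.\<close>
    obtain T2 where T2: "orthogonal_transformation T2" "T2 (T1 r) = s *\<^sub>R axis j 1"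
        "\<And>y. y \<bullet> (T1 r - s *\<^sub>R axis j 1) = 0 \<Longrightarrow> T2 y = y"
      using exists_orthogonal_transformation_reflection[of "T1 r" "s *\<^sub>R axis j 1"] T1(1)
      by (auto simp: s_def orthogonal_transformation_norm)
    define T where "T = T2 \<circ> T1"
    have T: "orthogonal_transformation T"
      unfolding T_def using T1 T2 by (intro orthogonal_transformation_compose)
    have Tv: "T v = axis i 1"
    proof -
      have "axis i 1 \<bullet> (T1 r - s *\<^sub>R axis j 1) = 0"
        using T1ri ij by (simp add: inner_axis' axis_def[of j])
      then show ?thesis by (simp add: T_def T1(2) T2(3))
    qed
    have lin: "linear T" using T by (rule orthogonal_transformation_linear)
    have "T w = T (c *\<^sub>R v + r)" by (simp add: r_def)
    also have "\<dots> = c *\<^sub>R axis i 1 + s *\<^sub>R axis j 1"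
      using Tv T2(2) by (simp only: linear_add[OF lin] linear_scale[OF lin]) (simp add: T_def)
    finally have Tw: "T w = c *\<^sub>R axis i 1 + s *\<^sub>R axis j 1" .
    have "(\<integral>x. \<bar>v \<bullet> x\<bar> * \<bar>w \<bullet> x\<bar> \<partial>std_gauss) = (\<integral>x. \<bar>T v \<bullet> T x\<bar> * \<bar>T w \<bullet> T x\<bar> \<partial>std_gauss)"
      using T by (simp add: orthogonal_transformation_def)
    also have "\<dots> = (\<integral>x. \<bar>T v \<bullet> x\<bar> * \<bar>T w \<bullet> x\<bar> \<partial>std_gauss)"
      by (rule integral_std_gauss_orthogonal[OF T, of "\<lambda>x. \<bar>T v \<bullet> x\<bar> * \<bar>T w \<bullet> x\<bar>"]) measurable
    also have "\<dots> = (\<integral>x. \<bar>x $ i\<bar> * \<bar>c * x $ i + s * x $ j\<bar> \<partial>std_gauss)"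
      unfolding Tv Tw by (simp add: inner_axis' inner_add_left)
    also have "\<dots> = enn2real (\<integral>\<^sup>+x. ennreal (\<bar>x $ i\<bar> * \<bar>c * x $ i + s * x $ j\<bar>) \<partial>std_gauss)"
      by (intro integral_eq_nn_integral) auto
    also have "(\<integral>\<^sup>+x. ennreal (\<bar>x $ i\<bar> * \<bar>c * x $ i + s * x $ j\<bar>) \<partial>std_gauss)
      = (\<integral>\<^sup>+p. ennreal (\<bar>fst p\<bar> * \<bar>c * fst p + s * snd p\<bar>)
          \<partial>distr std_gauss (borel \<Otimes>\<^sub>M borel) (\<lambda>x. (x $ i, x $ j)))"
      by (subst nn_integral_distr) auto
    also have "\<dots> = ennreal (2 / pi * (s + c * arcsin c))"
      unfolding distr_std_gauss_nth_nth[OF ij, symmetric] by (rule nn_integral_pair_std_normal_abs[OF s(2,1)])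
    also have "enn2real \<dots> = 2 / pi * (s + c * arcsin c)"
    proof -
      have "0 \<le> c * arcsin c"
        using c1 arcsin_le_arcsin[of 0 c] arcsin_le_arcsin[of c 0]
        by (cases "0 \<le> c") (auto intro: mult_nonneg_nonneg mult_nonpos_nonpos)
      then show ?thesis using s(1) by (intro enn2real_ennreal mult_nonneg_nonneg) auto
    qed
    finally show ?thesis using s(3) by (simp add: c_def)
  qed
qed

section \<open>An inequality between angles\<close>

text \<open>Comparing derivatives reduces the claim to \<open>4 c\<^sup>2 (1 + c\<^sup>2) \<le> (1 + 2 c\<^sup>2)\<^sup>2\<close> with \<open>c = cos s\<close>.\<close>

lemma double_angle_le_cubic:
  fixes s :: real
  assumes "0 \<le> s" "s \<le> pi / 2"
  shows "2 * s - sin (2 * s) * cos (2 * s) \<le> 4 * sin s ^ 3 * sqrt (1 + (cos s)\<^sup>2)"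
proof -
  let ?f = "\<lambda>s::real. 4 * sin s ^ 3 * sqrt (1 + (cos s)\<^sup>2) - (2 * s - sin (2 * s) * cos (2 * s))"
  have "?f 0 \<le> ?f s"
  proof (rule DERIV_nonneg_imp_nondecreasing[OF assms(1)])
    fix x assume x: "0 \<le> x" "x \<le> s"
    define q where "q = sqrt (1 + (cos x)\<^sup>2)"
    have pos: "1 + (cos x)\<^sup>2 > 0" by (simp add: add_pos_nonneg)
    then have q: "q > 0" "q\<^sup>2 = 1 + (cos x)\<^sup>2" by (auto simp: q_def)
    have c: "cos x \<ge> 0" using x assms by (intro cos_ge_zero) auto
    have d1: "((\<lambda>s. 4 * sin s ^ 3 * sqrt (1 + (cos s)\<^sup>2)) has_real_derivative
        12 * (sin x)\<^sup>2 * cos x * q - 4 * sin x ^ 3 * (cos x * sin x) / q) (at x)"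
      using pos unfolding q_def
      by (auto intro!: derivative_eq_intros simp: field_simps)
    have d2: "((\<lambda>s. 2 * s - sin (2 * s) * cos (2 * s)) has_real_derivative
        2 - 2 * (cos (2 * x))\<^sup>2 + 2 * (sin (2 * x))\<^sup>2) (at x)"
      by (auto intro!: derivative_eq_intros simp: power2_eq_square)
    have e2: "2 - 2 * (cos (2 * x))\<^sup>2 + 2 * (sin (2 * x))\<^sup>2 = 16 * (sin x)\<^sup>2 * (cos x)\<^sup>2"
      unfolding cos_squared_eq[of "2 * x"] sin_double by (simp add: power_mult_distrib)
    have "4 * (cos x)\<^sup>2 * q\<^sup>2 \<le> (1 + 2 * (cos x)\<^sup>2)\<^sup>2"
      unfolding q(2) by (simp add: power2_eq_square algebra_simps)
    then have "(2 * cos x * q)\<^sup>2 \<le> (1 + 2 * (cos x)\<^sup>2)\<^sup>2" by (simp add: power_mult_distrib)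
    then have key: "2 * cos x * q \<le> 1 + 2 * (cos x)\<^sup>2"
      by (rule power2_le_imp_le) simp
    have "12 * (sin x)\<^sup>2 * cos x * q - 4 * sin x ^ 3 * (cos x * sin x) / q - 16 * (sin x)\<^sup>2 * (cos x)\<^sup>2
      = 4 * (sin x)\<^sup>2 * cos x * (3 * q\<^sup>2 - (sin x)\<^sup>2 - 4 * cos x * q) / q"
      using q(1) by (simp add: field_simps power2_eq_square power3_eq_cube)
    also have "3 * q\<^sup>2 - (sin x)\<^sup>2 - 4 * cos x * q = 2 * (1 + 2 * (cos x)\<^sup>2 - 2 * cos x * q)"
      unfolding q(2) sin_squared_eq by simp
    also have "4 * (sin x)\<^sup>2 * cos x * (2 * (1 + 2 * (cos x)\<^sup>2 - 2 * cos x * q)) / q \<ge> 0"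
      using key c q(1) by (intro divide_nonneg_pos mult_nonneg_nonneg) auto
    finally have "0 \<le> 12 * (sin x)\<^sup>2 * cos x * q - 4 * sin x ^ 3 * (cos x * sin x) / q
        - (2 - 2 * (cos (2 * x))\<^sup>2 + 2 * (sin (2 * x))\<^sup>2)"
      unfolding e2 .
    with DERIV_diff[OF d1 d2]
    show "\<exists>y. (?f has_real_derivative y) (at x) \<and> 0 \<le> y" by blast
  qed
  then show ?thesis by simp
qed

text \<open>With \<open>s = d / 2\<close>, the difference \<open>2 - 2 * cos d\<close> and the
  bounds for the other two terms all carry the factor \<open>4 * (sin s)\<^sup>2\<close>. What
  stands beside it is at most 1 by Cauchy-Schwarz in the plane, because
  \<open>cos s ^ 4 + (sin s)\<^sup>2 * (1 + (cos s)\<^sup>2) = 1\<close>.\<close>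

lemma planar_angle_inequality_nonneg:
  fixes A d :: real
  assumes "0 \<le> d" "d \<le> pi"
  shows "2 * cos d + cos A * (sin d)\<^sup>2 + \<bar>sin A\<bar> * (d - sin d * cos d) \<le> 2"
proof -
  define s where "s = d / 2"
  have s: "0 \<le> s" "s \<le> pi / 2" "d = 2 * s" using assms by (auto simp: s_def)
  let ?c = "cos s" and ?q = "sqrt (1 + (cos s)\<^sup>2)"
  have ss: "0 \<le> sin s" using s by (intro sin_ge_zero) auto
  have q: "?q\<^sup>2 = 1 + ?c\<^sup>2" by (simp add: add_nonneg_nonneg)
  have "cos A * (sin d)\<^sup>2 + \<bar>sin A\<bar> * (d - sin d * cos d)
      \<le> \<bar>cos A\<bar> * (4 * (sin s)\<^sup>2 * ?c\<^sup>2) + \<bar>sin A\<bar> * (4 * sin s ^ 3 * ?q)"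
  proof (intro add_mono mult_left_mono)
    have "(sin d)\<^sup>2 = 4 * (sin s)\<^sup>2 * ?c\<^sup>2" by (simp add: s(3) sin_double power_mult_distrib)
    then show "cos A * (sin d)\<^sup>2 \<le> \<bar>cos A\<bar> * (4 * (sin s)\<^sup>2 * ?c\<^sup>2)"
      by (metis abs_ge_self mult_right_mono zero_le_power2)
    show "d - sin d * cos d \<le> 4 * sin s ^ 3 * ?q"
      unfolding s(3) by (rule double_angle_le_cubic[OF s(1,2)])
  qed simp
  also have "\<dots> = 4 * (sin s)\<^sup>2 * (\<bar>cos A\<bar> * ?c\<^sup>2 + \<bar>sin A\<bar> * (sin s * ?q))"
    by (simp add: algebra_simps power2_eq_square power3_eq_cube)
  also have "\<dots> \<le> 4 * (sin s)\<^sup>2 * 1"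
  proof (intro mult_left_mono)
    let ?X = "\<bar>cos A\<bar> * ?c\<^sup>2 + \<bar>sin A\<bar> * (sin s * ?q)"
    have "?X\<^sup>2 \<le> (\<bar>cos A\<bar>\<^sup>2 + \<bar>sin A\<bar>\<^sup>2) * ((?c\<^sup>2)\<^sup>2 + (sin s * ?q)\<^sup>2)"
      using zero_le_power2[of "\<bar>cos A\<bar> * (sin s * ?q) - \<bar>sin A\<bar> * ?c\<^sup>2"]
      by (simp only: power2_eq_square) (simp only: algebra_simps)
    also have "\<dots> = (?c\<^sup>2)\<^sup>2 + (sin s)\<^sup>2 * ?q\<^sup>2" by (simp add: power_mult_distrib)
    also have "\<dots> = 1\<^sup>2" unfolding q sin_squared_eq by (simp add: power2_eq_square algebra_simps)
    finally show "?X \<le> 1" by (rule power2_le_imp_le) simp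
  qed simp
  also have "\<dots> = 2 - 2 * cos d" by (simp add: s(3) cos_double_sin)
  finally show ?thesis by simp
qed

lemma sin_mult_cos_le:
  fixes d :: real
  assumes "0 \<le> d"
  shows "sin d * cos d \<le> d"
  using sin_x_le_x[of "2 * d"] assms by (simp add: sin_double)

text \<open>\<open>A\<close> and \<open>C\<close> stand for \<open>arcsin (v \<bullet> w')\<close>
  and \<open>arcsin (v \<bullet> w)\<close>, and \<open>e\<close> for \<open>w \<bullet> w'\<close>,
  all vectors being of norm 1. Collected on the left, \<open>e\<close> has the nonnegative
  coefficient \<open>2 - cos C\<close>, so the extreme case is \<open>e = cos (A - C)\<close>, the
  coplanar configuration. A negative \<open>A - C\<close> is reduced to its opposite, since the
  preceding lemma contains \<open>\<bar>sin A\<bar>\<close>.\<close>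

lemma planar_angle_inequality:
  fixes A C e :: real
  assumes A: "\<bar>A\<bar> \<le> pi / 2" and C: "\<bar>C\<bar> \<le> pi / 2" and e: "e \<le> cos (A - C)"
  shows "cos A + A * sin A - e * cos C - sin A * C \<le> 2 * (1 - e)"
proof -
  define d where "d = A - C"
  have CA: "C = A - d" by (simp add: d_def)
  have "2 * cos d + cos A * (sin d)\<^sup>2 + sin A * (d - sin d * cos d) \<le> 2"
  proof (cases "0 \<le> d")
    case True
    have dpi: "d \<le> pi" using A C by (auto simp: d_def)
    have sc: "0 \<le> d - sin d * cos d"
      using True sin_mult_cos_le[of d] by simp
    show ?thesis
      using planar_angle_inequality_nonneg[OF True dpi, of A] mult_right_mono[OF abs_ge_self[of "sin A"] sc] by linarith
  next
    case False
    then have "0 \<le> - d" "- d \<le> pi" using A C by (auto simp: d_def)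
    note * = planar_angle_inequality_nonneg[OF this, of A]
    have sc: "0 \<le> - d - sin (- d) * cos (- d)"
      using False sin_mult_cos_le[of "- d"] by simp
    have "sin A * (d - sin d * cos d) = - sin A * (- d - sin (- d) * cos (- d))" by (simp add: algebra_simps)
    also have "\<dots> \<le> \<bar>sin A\<bar> * (- d - sin (- d) * cos (- d))"
      by (intro mult_right_mono sc) auto
    finally show ?thesis using * by simp
  qed
  moreover have "(2 - cos C) * e \<le> (2 - cos C) * cos d"
    using e cos_le_one[of C] by (intro mult_left_mono) (auto simp: d_def intro: order_trans[OF cos_le_one])
  moreover have "cos C * cos d = cos A - cos A * (sin d)\<^sup>2 + sin A * sin d * cos d"
    unfolding CA cos_diff sin_squared_eq by (simp add: power2_eq_square algebra_simps)
  ultimately show ?thesis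
    by (simp add: d_def algebra_simps)
qed

section \<open>The sharp bound for the linearisation error of one neuron\<close>

text \<open>Positive homogeneity in \<open>w\<close> removes the normalisation. Writing the norm as
  \<open>sqrt (w \<bullet> w)\<close> keeps the formula explicit in inner products, ready to be
  differentiated along \<open>w + t *\<^sub>R z\<close>.\<close>

lemma integral_std_gauss_abs_abs:
  fixes v w :: "real ^ 'k::finite"
  assumes v: "norm v = 1" and w: "w \<noteq> 0"
  shows "(\<integral>x. \<bar>v \<bullet> x\<bar> * \<bar>w \<bullet> x\<bar> \<partial>std_gauss)
    = 2 / pi * (sqrt (w \<bullet> w - (v \<bullet> w)\<^sup>2) + (v \<bullet> w) * arcsin (v \<bullet> w / sqrt (w \<bullet> w)))"
proof -
  define n where "n = norm w"
  have n: "n > 0" "sqrt (w \<bullet> w) = n" "w \<bullet> w = n\<^sup>2"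
    using w by (auto simp: n_def norm_eq_sqrt_inner power2_norm_eq_inner)
  define u where "u = (1 / n) *\<^sub>R w"
  have u: "norm u = 1" "w = n *\<^sub>R u" using n w by (auto simp: u_def n_def)
  have "(\<integral>x. \<bar>v \<bullet> x\<bar> * \<bar>w \<bullet> x\<bar> \<partial>std_gauss) = (\<integral>x. n * (\<bar>v \<bullet> x\<bar> * \<bar>u \<bullet> x\<bar>) \<partial>std_gauss)"
    unfolding u(2) using n by (simp add: abs_mult mult_ac)
  also have "\<dots> = n * (2 / pi * (sqrt (1 - (v \<bullet> u)\<^sup>2) + (v \<bullet> u) * arcsin (v \<bullet> u)))"
    by (simp only: integral_mult_right_zero integral_std_gauss_abs_abs_unit[OF v u(1)])
  also have "\<dots> = 2 / pi * (n * sqrt (1 - (v \<bullet> u)\<^sup>2) + (n * (v \<bullet> u)) * arcsin (v \<bullet> u))"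
    by (simp add: algebra_simps)
  also have "n * sqrt (1 - (v \<bullet> u)\<^sup>2) = sqrt (n\<^sup>2 * (1 - (v \<bullet> u)\<^sup>2))"
    using n by (simp add: real_sqrt_mult)
  also have "n\<^sup>2 * (1 - (v \<bullet> u)\<^sup>2) = w \<bullet> w - (v \<bullet> w)\<^sup>2"
    unfolding n(3) by (simp add: u(2) power_mult_distrib algebra_simps)
  also have "n * (v \<bullet> u) = v \<bullet> w" by (simp add: u(2))
  also have "v \<bullet> u = v \<bullet> w / sqrt (w \<bullet> w)" unfolding n(2) using n(1) by (simp add: u(2))
  finally show ?thesis .
qed

lemma borel_measurable_sgn_inner [measurable]:
  "(\<lambda>x::real^'k::finite. sgn (w \<bullet> x)) \<in> borel_measurable borel"
  unfolding sgn_if by measurable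

lemma integrable_std_gauss_abs_abs:
  fixes v w :: "real ^ 'k::finite"
  shows "integrable std_gauss (\<lambda>x. \<bar>v \<bullet> x\<bar> * \<bar>w \<bullet> x\<bar>)"
  by (rule integrable_std_gauss_inner_bound[of _ v w]) auto

lemma integrable_std_gauss_abs_sgn:
  fixes v w z :: "real ^ 'k::finite"
  shows "integrable std_gauss (\<lambda>x. \<bar>v \<bullet> x\<bar> * (sgn (w \<bullet> x) * (z \<bullet> x)))"
  by (rule integrable_std_gauss_inner_bound[of _ v z])
    (auto simp: abs_mult sgn_if)

text \<open>By convexity of \<open>\<lambda>t. E (\<bar>v \<bullet> x\<bar> * \<bar>(w + t z) \<bullet> x\<bar>)\<close> the integral on the left is a subgradient at
  \<open>t = 0\<close>, hence the derivative, which is read off the closed form.\<close>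

lemma integral_std_gauss_abs_sgn:
  fixes v w z :: "real ^ 'k::finite"
  assumes v: "norm v = 1" and w: "norm w = 1"
  shows "(\<integral>x. \<bar>v \<bullet> x\<bar> * (sgn (w \<bullet> x) * (z \<bullet> x)) \<partial>std_gauss)
    = 2 / pi * ((w \<bullet> z) * sqrt (1 - (v \<bullet> w)\<^sup>2) + (v \<bullet> z) * arcsin (v \<bullet> w))"
proof -
  define c where "c = v \<bullet> w"
  define H where "H = (\<integral>x. \<bar>v \<bullet> x\<bar> * (sgn (w \<bullet> x) * (z \<bullet> x)) \<partial>std_gauss)"
  have vv: "v \<bullet> v = 1" and ww: "w \<bullet> w = 1" using v w by (auto simp: norm_eq_1)
  have c1: "\<bar>c\<bar> \<le> 1" using Cauchy_Schwarz_ineq2[of v w] v w by (simp add: c_def)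
  show ?thesis
  proof (cases "\<bar>c\<bar> = 1")
    \<comment> \<open>For \<open>\<bar>c\<bar> = 1\<close> the arcsine is not differentiable at
      \<open>c\<close>; there \<open>w\<close> is \<open>v\<close> or \<open>- v\<close>, and the
      integral reduces to a second moment.\<close>
    case True
    then have cc: "c\<^sup>2 = 1" by (metis abs_power2 one_power2 power_abs)
    have "(w - c *\<^sub>R v) \<bullet> (w - c *\<^sub>R v) = 0"
      using cc by (simp add: inner_diff_left inner_diff_right vv ww inner_commute power2_eq_square flip: c_def)
    then have wv: "w = c *\<^sub>R v" by simp
    have "\<bar>v \<bullet> x\<bar> * (sgn (w \<bullet> x) * (z \<bullet> x)) = c * ((v \<bullet> x) * (z \<bullet> x))" for x
    proof -
      have "sgn c = c" using True by (auto simp: sgn_if abs_if split: if_splits)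
      then have "\<bar>v \<bullet> x\<bar> * sgn (w \<bullet> x) = c * (v \<bullet> x)"
        unfolding wv by (simp add: sgn_mult abs_mult_sgn mult.left_commute)
      then show ?thesis by (simp add: mult.assoc[symmetric])
    qed
    then have "H = c * (v \<bullet> z)"
      unfolding H_def by (simp only: integral_mult_right_zero integral_std_gauss_inner_mult)
    moreover have "arcsin c = c * (pi / 2)" using True by (auto simp: abs_if split: if_splits)
    ultimately show ?thesis unfolding H_def[symmetric] c_def[symmetric] cc by (simp only:) simp
  next
    case False
    then have c: "-1 < c" "c < 1" using c1 by auto
    have "w \<noteq> 0" using w by auto
    define s where "s = sqrt (1 - c\<^sup>2)"
    have "c\<^sup>2 < 1" using c by (simp add: abs_square_less_1)
    then have s: "s > 0" "s\<^sup>2 = 1 - c\<^sup>2" by (auto simp: s_def)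
    define f where "f t = 2 / pi * (sqrt ((w + t *\<^sub>R z) \<bullet> (w + t *\<^sub>R z) - (v \<bullet> (w + t *\<^sub>R z))\<^sup>2)
        + (v \<bullet> (w + t *\<^sub>R z)) * arcsin (v \<bullet> (w + t *\<^sub>R z) / sqrt ((w + t *\<^sub>R z) \<bullet> (w + t *\<^sub>R z))))" for t
    have f: "f t = 2 / pi * (sqrt (1 + 2 * (w \<bullet> z) * t + (z \<bullet> z) * t\<^sup>2 - (c + (v \<bullet> z) * t)\<^sup>2)
        + (c + (v \<bullet> z) * t) * arcsin ((c + (v \<bullet> z) * t) / sqrt (1 + 2 * (w \<bullet> z) * t + (z \<bullet> z) * t\<^sup>2)))" for t
      unfolding f_def
      by (simp add: inner_add_left inner_add_right ww c_def inner_commute power2_eq_square algebra_simps)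
    have d1: "((\<lambda>t. sqrt (1 + 2 * (w \<bullet> z) * t + (z \<bullet> z) * t\<^sup>2 - (c + (v \<bullet> z) * t)\<^sup>2))
        has_real_derivative ((w \<bullet> z) - c * (v \<bullet> z)) / s) (at 0)"
      using \<open>c\<^sup>2 < 1\<close> by (auto intro!: derivative_eq_intros simp: s_def field_simps)
    have d2: "((\<lambda>t. (c + (v \<bullet> z) * t) / sqrt (1 + 2 * (w \<bullet> z) * t + (z \<bullet> z) * t\<^sup>2))
        has_real_derivative (v \<bullet> z) - c * (w \<bullet> z)) (at 0)"
      by (auto intro!: derivative_eq_intros simp: field_simps)
    have d3: "((\<lambda>t. arcsin ((c + (v \<bullet> z) * t) / sqrt (1 + 2 * (w \<bullet> z) * t + (z \<bullet> z) * t\<^sup>2)))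
        has_real_derivative inverse s * ((v \<bullet> z) - c * (w \<bullet> z))) (at 0)"
    proof (rule DERIV_chain2[OF _ d2])
      show "(arcsin has_real_derivative inverse s) (at ((c + (v \<bullet> z) * 0) / sqrt (1 + 2 * (w \<bullet> z) * 0 + (z \<bullet> z) * 0\<^sup>2)))"
        using DERIV_arcsin[OF c] by (simp add: s_def)
    qed
    have d4: "((\<lambda>t. c + (v \<bullet> z) * t) has_real_derivative (v \<bullet> z)) (at 0)"
      by (auto intro!: derivative_eq_intros)
    have "(f has_real_derivative 2 / pi * (((w \<bullet> z) - c * (v \<bullet> z)) / s
        + ((v \<bullet> z) * arcsin c + inverse s * ((v \<bullet> z) - c * (w \<bullet> z)) * c))) (at 0)"
      unfolding f using DERIV_cmult[OF DERIV_add[OF d1 DERIV_mult[OF d4 d3]], of "2 / pi"] by simp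
    moreover have "((w \<bullet> z) - c * (v \<bullet> z)) / s + ((v \<bullet> z) * arcsin c + inverse s * ((v \<bullet> z) - c * (w \<bullet> z)) * c)
        = (w \<bullet> z) * s + (v \<bullet> z) * arcsin c"
    proof -
      have "((w \<bullet> z) - c * (v \<bullet> z)) / s + inverse s * ((v \<bullet> z) - c * (w \<bullet> z)) * c = (w \<bullet> z) * (1 - c\<^sup>2) / s"
        using s(1) by (simp add: field_simps power2_eq_square)
      also have "\<dots> = (w \<bullet> z) * s" unfolding s(2)[symmetric] using s(1) by (simp add: power2_eq_square)
      finally show ?thesis by simp
    qed
    ultimately have df: "(f has_real_derivative 2 / pi * ((w \<bullet> z) * s + (v \<bullet> z) * arcsin c)) (at 0)"
      by simp
    have fE: "f t = (\<integral>x. \<bar>v \<bullet> x\<bar> * \<bar>(w + t *\<^sub>R z) \<bullet> x\<bar> \<partial>std_gauss)" if "w + t *\<^sub>R z \<noteq> 0" for t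
      unfolding f_def using integral_std_gauss_abs_abs[OF v that] by simp
    \<comment> \<open>The bound on \<open>t\<close> keeps \<open>w + t *\<^sub>R z\<close> away from
      0, so that the closed form applies. The inequality itself is
      \<open>sgn a * b \<le> \<bar>b\<bar>\<close>, weighted and integrated.\<close>
    have ineq: "f 0 - 0 * H \<le> f t - t * H" if t: "\<bar>t\<bar> < 1 / (1 + norm z)" for t
    proof -
      have nz: "0 < 1 + norm z" by (simp add: add_pos_nonneg)
      have "\<bar>t\<bar> * (1 + norm z) < 1" using t nz by (simp add: field_simps)
      then have "norm (t *\<^sub>R z) < 1" by (simp add: algebra_simps)
      then have t0: "w + t *\<^sub>R z \<noteq> 0" using w by (metis add.inverse_unique norm_minus_cancel order_less_irrefl)
      have "f 0 + t * H = (\<integral>x. \<bar>v \<bullet> x\<bar> * \<bar>w \<bullet> x\<bar> + t * (\<bar>v \<bullet> x\<bar> * (sgn (w \<bullet> x) * (z \<bullet> x))) \<partial>std_gauss)"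
        using fE[of 0] \<open>w \<noteq> 0\<close> unfolding H_def
        by (subst Bochner_Integration.integral_add)
          (auto intro!: integrable_mult_right integrable_std_gauss_abs_abs integrable_std_gauss_abs_sgn)
      also have "\<dots> \<le> (\<integral>x. \<bar>v \<bullet> x\<bar> * \<bar>(w + t *\<^sub>R z) \<bullet> x\<bar> \<partial>std_gauss)"
      proof (intro integral_mono Bochner_Integration.integrable_add integrable_mult_right
          integrable_std_gauss_abs_abs integrable_std_gauss_abs_sgn)
        fix x
        have "\<bar>w \<bullet> x\<bar> + t * (sgn (w \<bullet> x) * (z \<bullet> x)) = sgn (w \<bullet> x) * ((w + t *\<^sub>R z) \<bullet> x)"
          by (simp add: inner_add_left algebra_simps abs_sgn)
        also have "\<dots> \<le> \<bar>(w + t *\<^sub>R z) \<bullet> x\<bar>" by (auto simp: sgn_if)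
        finally show "\<bar>v \<bullet> x\<bar> * \<bar>w \<bullet> x\<bar> + t * (\<bar>v \<bullet> x\<bar> * (sgn (w \<bullet> x) * (z \<bullet> x))) \<le> \<bar>v \<bullet> x\<bar> * \<bar>(w + t *\<^sub>R z) \<bullet> x\<bar>"
          using mult_left_mono[of _ _ "\<bar>v \<bullet> x\<bar>"] by (fastforce simp: algebra_simps)
      qed
      also have "\<dots> = f t" using fE[OF t0] by simp
      finally show ?thesis by simp
    qed
    \<comment> \<open>\<open>t = 0\<close> is a local minimum of \<open>f t - t * H\<close>, so the
      derivative of \<open>f\<close> there must be \<open>H\<close>.\<close>
    have "((\<lambda>t. f t - t * H) has_real_derivative 2 / pi * ((w \<bullet> z) * s + (v \<bullet> z) * arcsin c) - H) (at 0)"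
      by (intro DERIV_diff df) (auto intro!: derivative_eq_intros)
    then have "2 / pi * ((w \<bullet> z) * s + (v \<bullet> z) * arcsin c) - H = 0"
    proof (rule DERIV_local_min)
      show "0 < 1 / (1 + norm z)" by (simp add: add_pos_nonneg)
      show "\<forall>t. \<bar>0 - t\<bar> < 1 / (1 + norm z) \<longrightarrow> f 0 - 0 * H \<le> f t - t * H" using ineq by simp
    qed
    then show ?thesis by (simp add: H_def s_def c_def)
  qed
qed

text \<open>The two closed forms turn the integral into the left side of the planar inequality for
  the arcsines \<open>A\<close> and \<open>C\<close>. The hypothesis
  \<open>e \<le> cos (A - C)\<close> is Cauchy-Schwarz for the components of \<open>w\<close> and
  \<open>w'\<close> orthogonal to \<open>v\<close>, whose norms are \<open>cos C\<close> and
  \<open>cos A\<close>.\<close>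

lemma integral_std_gauss_abs_linearisation_unit:
  fixes v w w' :: "real ^ 'k::finite"
  assumes v: "norm v = 1" and w: "norm w = 1" and w': "norm w' = 1"
  shows "(\<integral>x. \<bar>v \<bullet> x\<bar> * (\<bar>w' \<bullet> x\<bar> - sgn (w \<bullet> x) * (w' \<bullet> x)) \<partial>std_gauss) \<le> 4 / pi * (1 - w \<bullet> w')"
proof -
  define a where "a = v \<bullet> w'"
  define c where "c = v \<bullet> w"
  define e where "e = w \<bullet> w'"
  have vv: "v \<bullet> v = 1" and ww: "w \<bullet> w = 1" "w' \<bullet> w' = 1" using v w w' by (auto simp: norm_eq_1)
  have a1: "\<bar>a\<bar> \<le> 1" and c1: "\<bar>c\<bar> \<le> 1"
    using Cauchy_Schwarz_ineq2[of v w'] Cauchy_Schwarz_ineq2[of v w] v w w' by (auto simp: a_def c_def)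
  define A where "A = arcsin a"
  define C where "C = arcsin c"
  have A: "\<bar>A\<bar> \<le> pi / 2" "sin A = a" "cos A = sqrt (1 - a\<^sup>2)"
    and C: "\<bar>C\<bar> \<le> pi / 2" "sin C = c" "cos C = sqrt (1 - c\<^sup>2)"
    using a1 c1 arcsin_bounded[of a] arcsin_bounded[of c] by (auto simp: A_def C_def cos_arcsin abs_le_iff)
  have "(w - c *\<^sub>R v) \<bullet> (w' - a *\<^sub>R v) \<le> norm (w - c *\<^sub>R v) * norm (w' - a *\<^sub>R v)"
    by (rule norm_cauchy_schwarz)
  also have "norm (w - c *\<^sub>R v) = cos C"
    unfolding C(3) norm_eq_sqrt_inner
    by (simp add: inner_diff_left inner_diff_right vv ww inner_commute power2_eq_square flip: c_def)
  also have "norm (w' - a *\<^sub>R v) = cos A"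
    unfolding A(3) norm_eq_sqrt_inner
    by (simp add: inner_diff_left inner_diff_right vv ww inner_commute power2_eq_square flip: a_def)
  also have "(w - c *\<^sub>R v) \<bullet> (w' - a *\<^sub>R v) = e - sin A * sin C"
    unfolding A(2) C(2)
    by (simp add: inner_diff_left inner_diff_right vv inner_commute[of w v] flip: a_def c_def e_def)
  finally have "e \<le> cos (A - C)" by (simp add: cos_diff mult.commute)
  note * = planar_angle_inequality[OF A(1) C(1) this]
  have "(\<integral>x. \<bar>v \<bullet> x\<bar> * (\<bar>w' \<bullet> x\<bar> - sgn (w \<bullet> x) * (w' \<bullet> x)) \<partial>std_gauss)
    = (\<integral>x. \<bar>v \<bullet> x\<bar> * \<bar>w' \<bullet> x\<bar> \<partial>std_gauss) - (\<integral>x. \<bar>v \<bullet> x\<bar> * (sgn (w \<bullet> x) * (w' \<bullet> x)) \<partial>std_gauss)"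
    unfolding right_diff_distrib
    by (intro Bochner_Integration.integral_diff integrable_std_gauss_abs_abs integrable_std_gauss_abs_sgn)
  also have "\<dots> = 2 / pi * (cos A + A * sin A - e * cos C - sin A * C)"
    unfolding integral_std_gauss_abs_abs_unit[OF v w'] integral_std_gauss_abs_sgn[OF v w]
      a_def[symmetric] c_def[symmetric] e_def[symmetric] A_def[symmetric] C_def[symmetric] A(3)[symmetric] C(3)[symmetric]
    by (simp add: A(2) algebra_simps)
  also have "\<dots> \<le> 2 / pi * (2 * (1 - e))" using * by (intro mult_left_mono) auto
  finally show ?thesis by (simp add: e_def)
qed

lemma integral_std_gauss_abs_linearisation:
  fixes v w w' :: "real ^ 'k::finite"
  assumes w: "w \<noteq> 0"
  shows "(\<integral>x. \<bar>v \<bullet> x\<bar> * (\<bar>w' \<bullet> x\<bar> - sgn (w \<bullet> x) * (w' \<bullet> x)) \<partial>std_gauss)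
    \<le> 4 / pi * norm v * (norm w' - (w \<bullet> w') / norm w)"
proof (cases "v = 0 \<or> w' = 0")
  case True
  then show ?thesis by auto
next
  case False
  have unit: "norm (y /\<^sub>R norm y) = 1" "y = norm y *\<^sub>R (y /\<^sub>R norm y)" if "y \<noteq> 0" for y :: "real^'k"
    using that by auto
  let ?v = "v /\<^sub>R norm v" and ?w = "w /\<^sub>R norm w" and ?w' = "w' /\<^sub>R norm w'"
  have "\<bar>v \<bullet> x\<bar> * (\<bar>w' \<bullet> x\<bar> - sgn (w \<bullet> x) * (w' \<bullet> x))
     = norm v * norm w' * (\<bar>?v \<bullet> x\<bar> * (\<bar>?w' \<bullet> x\<bar> - sgn (?w \<bullet> x) * (?w' \<bullet> x)))" for x
  proof -
    have "\<bar>v \<bullet> x\<bar> = norm v * \<bar>?v \<bullet> x\<bar>" "\<bar>w' \<bullet> x\<bar> = norm w' * \<bar>?w' \<bullet> x\<bar>" "w' \<bullet> x = norm w' * (?w' \<bullet> x)"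
        "sgn (w \<bullet> x) = sgn (?w \<bullet> x)"
      using False w by (auto simp: abs_mult sgn_mult)
    then show ?thesis by (simp only: algebra_simps)
  qed
  then have "(\<integral>x. \<bar>v \<bullet> x\<bar> * (\<bar>w' \<bullet> x\<bar> - sgn (w \<bullet> x) * (w' \<bullet> x)) \<partial>std_gauss)
     = norm v * norm w' * (\<integral>x. \<bar>?v \<bullet> x\<bar> * (\<bar>?w' \<bullet> x\<bar> - sgn (?w \<bullet> x) * (?w' \<bullet> x)) \<partial>std_gauss)"
    by (simp only: integral_mult_right_zero)
  also have "\<dots> \<le> norm v * norm w' * (4 / pi * (1 - ?w \<bullet> ?w'))"
    using False w by (intro mult_left_mono integral_std_gauss_abs_linearisation_unit unit) auto
  also have "\<dots> = 4 / pi * norm v * (norm w' - (w \<bullet> w') / norm w)"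
    using False w by (simp add: field_simps)
  finally show ?thesis .
qed

text \<open>Split \<open>relu y = (y + \<bar>y\<bar>) / 2\<close>. The error factor is even in
  \<open>x\<close>, so the linear half integrates to 0, and the other half is the preceding bound.
  The last step is \<open>2 * norm w * norm w' \<le> (norm w)\<^sup>2 + (norm
  w')\<^sup>2\<close>.\<close>

lemma integral_std_gauss_relu_linearisation:
  fixes v w w' :: "real ^ 'k::finite"
  assumes w: "w \<noteq> 0"
  shows "(\<integral>x. relu (v \<bullet> x) * ((\<bar>w' \<bullet> x\<bar> - sgn (w \<bullet> x) * (w' \<bullet> x)) / 2) \<partial>std_gauss)
    \<le> norm v * (norm (w' - w))\<^sup>2 / (2 * pi * norm w)"
proof -
  let ?R = "\<lambda>x. \<bar>w' \<bullet> x\<bar> - sgn (w \<bullet> x) * (w' \<bullet> x)"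
  have R: "\<bar>?R x\<bar> \<le> \<bar>(2 *\<^sub>R w') \<bullet> x\<bar>" for x by (auto simp: sgn_if)
  have i1: "integrable std_gauss (\<lambda>x. (v \<bullet> x) * ?R x)"
    by (rule integrable_std_gauss_inner_bound[of _ v "2 *\<^sub>R w'"]) (auto simp: abs_mult intro!: mult_left_mono R[simplified])
  have i2: "integrable std_gauss (\<lambda>x. \<bar>v \<bullet> x\<bar> * ?R x)"
    by (rule integrable_std_gauss_inner_bound[of _ v "2 *\<^sub>R w'"]) (auto simp: abs_mult intro!: mult_left_mono R[simplified])
  have "(\<integral>x. (v \<bullet> x) * ?R x \<partial>std_gauss) = (\<integral>x. (v \<bullet> (- x)) * ?R (- x) \<partial>std_gauss)"
    by (rule integral_std_gauss_orthogonal[symmetric, of uminus "\<lambda>x. (v \<bullet> x) * ?R x"])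
      (auto simp: orthogonal_transformation_neg[of "\<lambda>x. x"])
  also have "\<dots> = - (\<integral>x. (v \<bullet> x) * ?R x \<partial>std_gauss)"
    by (simp add: sgn_minus)
  finally have odd: "(\<integral>x. (v \<bullet> x) * ?R x \<partial>std_gauss) = 0" by simp
  have "(\<integral>x. relu (v \<bullet> x) * (?R x / 2) \<partial>std_gauss) = (\<integral>x. ((v \<bullet> x) * ?R x + \<bar>v \<bullet> x\<bar> * ?R x) / 4 \<partial>std_gauss)"
  proof -
    have "relu y * (r / 2) = (y * r + \<bar>y\<bar> * r) / 4" for y r
      by (auto simp: relu_def max_def)
    then show ?thesis by (simp only:)
  qed
  also have "\<dots> = (\<integral>x. \<bar>v \<bullet> x\<bar> * ?R x \<partial>std_gauss) / 4"
    using odd by (simp only: integral_divide_zero Bochner_Integration.integral_add[OF i1 i2] add_0)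
  also have "\<dots> \<le> 4 / pi * norm v * (norm w' - (w \<bullet> w') / norm w) / 4"
    by (intro divide_right_mono integral_std_gauss_abs_linearisation w) auto
  also have "\<dots> = norm v * (2 * (norm w * norm w' - w \<bullet> w')) / (2 * pi * norm w)"
    using w by (simp add: field_simps)
  also have "\<dots> \<le> norm v * (norm (w' - w))\<^sup>2 / (2 * pi * norm w)"
  proof (intro divide_right_mono mult_left_mono)
    have "(norm (w' - w))\<^sup>2 = (norm w')\<^sup>2 + (norm w)\<^sup>2 - 2 * (w \<bullet> w')"
      by (simp add: power2_norm_eq_inner inner_diff_left inner_diff_right inner_commute)
    then show "2 * (norm w * norm w' - w \<bullet> w') \<le> (norm (w' - w))\<^sup>2"
      using zero_le_power2[of "norm w - norm w'"] by (simp add: power2_diff)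
  qed auto
  finally show ?thesis .
qed

section \<open>The quadratic remainder of the loss\<close>

text \<open>A class closed under sums and differences in which the product of any two members is
  integrable under \<open>std_gauss\<close>. The bound has no constant term, which fits functions
  that are positively homogeneous in \<open>x\<close>.\<close>

definition linear_growth :: "(real ^ 'k::finite \<Rightarrow> real) \<Rightarrow> bool" where
  "linear_growth f \<longleftrightarrow> f \<in> borel_measurable borel \<and> (\<exists>K. \<forall>x. \<bar>f x\<bar> \<le> K * norm x)"

lemma linear_growth_measurable [measurable_dest]:
  "linear_growth f \<Longrightarrow> f \<in> borel_measurable borel"
  by (simp add: linear_growth_def)

lemma linear_growth_zero: "linear_growth (\<lambda>x. 0)"
  unfolding linear_growth_def by (auto intro: exI[of _ 0])

lemma linear_growth_add:
  assumes "linear_growth f" "linear_growth g"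
  shows "linear_growth (\<lambda>x. f x + g x)"
proof -
  obtain K L where K: "\<bar>f x\<bar> \<le> K * norm x" and L: "\<bar>g x\<bar> \<le> L * norm x" for x
    using assms unfolding linear_growth_def by blast
  have "\<bar>f x + g x\<bar> \<le> (K + L) * norm x" for x
    using K[of x] L[of x] by (simp add: distrib_right)
  then show ?thesis using assms unfolding linear_growth_def by (auto intro!: exI[of _ "K + L"])
qed

lemma linear_growth_diff:
  assumes "linear_growth f" "linear_growth g"
  shows "linear_growth (\<lambda>x. f x - g x)"
proof -
  obtain K L where K: "\<bar>f x\<bar> \<le> K * norm x" and L: "\<bar>g x\<bar> \<le> L * norm x" for x
    using assms unfolding linear_growth_def by blast
  have "\<bar>f x - g x\<bar> \<le> (K + L) * norm x" for x
    using K[of x] L[of x] by (simp add: distrib_right)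
  then show ?thesis using assms unfolding linear_growth_def by (auto intro!: exI[of _ "K + L"])
qed

lemma linear_growth_sum:
  assumes "\<And>i. i \<in> I \<Longrightarrow> linear_growth (f i)"
  shows "linear_growth (\<lambda>x. \<Sum>i\<in>I. f i x)"
  using assms
proof (induction I rule: infinite_finite_induct)
  case (insert i I)
  then show ?case by (simp add: linear_growth_add)
qed (simp_all add: linear_growth_zero)

lemma linear_growth_inner_bound:
  fixes a :: "real ^ 'k::finite"
  assumes "f \<in> borel_measurable borel" "\<And>x. \<bar>f x\<bar> \<le> \<bar>a \<bullet> x\<bar>"
  shows "linear_growth f"
  using assms Cauchy_Schwarz_ineq2[of a] order_trans unfolding linear_growth_def by blast

lemma borel_measurable_relu [measurable]: "relu \<in> borel_measurable borel"
  unfolding relu_def by measurable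

lemma linear_growth_relu: "linear_growth (\<lambda>x. relu (a \<bullet> x))"
  by (rule linear_growth_inner_bound[of _ a]) (auto simp: relu_def)

lemma integrable_std_gauss_linear_growth_mult:
  fixes f g :: "real ^ 'k::finite \<Rightarrow> real"
  assumes f: "linear_growth f" and g: "linear_growth g"
  shows "integrable std_gauss (\<lambda>x. f x * g x)"
proof -
  note [measurable] = linear_growth_measurable[OF f] linear_growth_measurable[OF g]
  obtain K L where K: "\<bar>f x\<bar> \<le> K * norm x" and L: "\<bar>g x\<bar> \<le> L * norm x" for x
    using assms unfolding linear_growth_def by blast
  \<comment> \<open>The squared norm is a finite sum of squared coordinates, each with a finite
    second moment.\<close>
  have nx: "(norm x)\<^sup>2 = (\<Sum>i\<in>UNIV. (axis i 1 \<bullet> x)\<^sup>2)" for x :: "real^'k"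
    by (simp only: power2_norm_eq_inner inner_vec_def[of x x] inner_axis') (simp add: power2_eq_square)
  show ?thesis
  proof (rule Bochner_Integration.integrable_bound)
    show "integrable std_gauss (\<lambda>x::real^'k. K * L * (norm x)\<^sup>2)"
      unfolding nx by (intro integrable_mult_right Bochner_Integration.integrable_sum integrable_std_gauss_inner_sq)
    show "AE x in std_gauss. norm (f x * g x) \<le> norm (K * L * (norm x)\<^sup>2)"
    proof (rule AE_I2)
      fix x
      have "\<bar>f x\<bar> * \<bar>g x\<bar> \<le> (K * norm x) * (L * norm x)"
        using K[of x] L[of x] by (intro mult_mono) (auto intro: order_trans[OF abs_ge_zero])
      also have "(K * norm x) * (L * norm x) = K * L * (norm x)\<^sup>2"
        by (simp add: power2_eq_square)
      finally have "\<bar>f x * g x\<bar> \<le> K * L * (norm x)\<^sup>2" unfolding abs_mult .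
      then show "norm (f x * g x) \<le> norm (K * L * (norm x)\<^sup>2)"
        unfolding real_norm_def by linarith
    qed
  qed measurable
qed

text \<open>The right-hand side uses the value \<open>1/2\<close> for the derivative of \<open>relu\<close> at \<open>0\<close>, which makes the error term
  even under \<open>(a, b) \<mapsto> (- a, - b)\<close>.\<close>

lemma relu_linearisation:
  "relu b - relu a = (1 + sgn a) / 2 * (b - a) + (\<bar>b\<bar> - sgn a * b) / 2"
  by (auto simp: relu_def max_def sgn_if field_simps)

lemma relu_linearisation_error_nonneg: "0 \<le> (\<bar>b\<bar> - sgn a * b) / (2::real)"
  by (auto simp: sgn_if)

text \<open>Bounding the two diagonal terms jointly avoids any factor \<open>1 / norm w\<close> and
  produces the isolated summand \<open>1/2\<close> of the final constant. For \<open>a > 0\<close>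
  and \<open>b \<ge> 0\<close> both sides agree; for \<open>a > 0\<close> and \<open>b < 0\<close>
  the slack is \<open>b\<^sup>2 / 2\<close>; for \<open>a \<le> 0\<close> only the Lipschitz bound
  remains.\<close>

lemma relu_diagonal_bound:
  "relu a * ((\<bar>b\<bar> - sgn a * b) / 2) + (relu b - relu a)\<^sup>2 / 2 \<le> (b - a)\<^sup>2 / 2"
proof (cases "a \<le> 0")
  case True
  then have "\<bar>relu b - relu a\<bar> \<le> \<bar>b - a\<bar>" by (auto simp: relu_def max_def)
  then have "(relu b - relu a)\<^sup>2 \<le> (b - a)\<^sup>2" by (simp add: abs_le_square_iff)
  then show ?thesis using True by (simp add: relu_def)
next
  case False
  then show ?thesis
    by (auto simp: relu_def max_def sgn_if power2_diff field_simps)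
qed

lemma abs_relu_diff_le: "\<bar>relu b - relu a\<bar> \<le> \<bar>b - a\<bar>"
  by (auto simp: relu_def max_def)

text \<open>The candidate for the derivative of the loss at \<open>w\<close> in direction
  \<open>h\<close>: formal differentiation under the integral, with \<open>(1 + sgn y) / 2\<close>
  as derivative of \<open>relu\<close>. Agreement with the gradient is deduced later from the size
  of the remainder.\<close>

definition loss_linear_part :: "(real ^ 'k) ^ 'k \<Rightarrow> (real ^ 'k::finite) ^ 'n::finite \<Rightarrow> (real ^ 'k) ^ 'n \<Rightarrow> real" where
  "loss_linear_part v w h = (\<integral>x. ((\<Sum>i\<in>UNIV. relu (w $ i \<bullet> x)) - (\<Sum>j\<in>UNIV. relu (v $ j \<bullet> x)))
     * (\<Sum>i\<in>UNIV. (1 + sgn (w $ i \<bullet> x)) / 2 * (h $ i \<bullet> x)) \<partial>std_gauss)"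

lemma loss_linear_part_scaleR: "loss_linear_part v w (t *\<^sub>R h) = t * loss_linear_part v w h"
proof -
  have "((\<Sum>i\<in>UNIV. relu (w $ i \<bullet> x)) - (\<Sum>j\<in>UNIV. relu (v $ j \<bullet> x)))
      * (\<Sum>i\<in>UNIV. (1 + sgn (w $ i \<bullet> x)) / 2 * ((t *\<^sub>R h) $ i \<bullet> x))
    = t * (((\<Sum>i\<in>UNIV. relu (w $ i \<bullet> x)) - (\<Sum>j\<in>UNIV. relu (v $ j \<bullet> x)))
      * (\<Sum>i\<in>UNIV. (1 + sgn (w $ i \<bullet> x)) / 2 * (h $ i \<bullet> x)))" for x
  proof -
    have "(\<Sum>i\<in>UNIV. (1 + sgn (w $ i \<bullet> x)) / 2 * ((t *\<^sub>R h) $ i \<bullet> x))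
      = t * (\<Sum>i\<in>UNIV. (1 + sgn (w $ i \<bullet> x)) / 2 * (h $ i \<bullet> x))"
      unfolding sum_distrib_left by (intro sum.cong) auto
    then show ?thesis by (simp only: mult.left_commute)
  qed
  then show ?thesis unfolding loss_linear_part_def by (simp only: integral_mult_right_zero)
qed

text \<open>With \<open>S = q - p = G + RR\<close> the integrand satisfies \<open>(q - t)\<^sup>2 /
  2 - (p - t)\<^sup>2 / 2 - (p - t) * G = (p - t) * RR + S\<^sup>2 / 2\<close>. Expanding the
  products into pairs of neurons isolates integrals that are estimated one by one.\<close>

lemma loss_F_expansion:
  fixes v :: "(real ^ 'k::finite) ^ 'k" and w w' :: "(real ^ 'k) ^ 'n::finite"
  defines "R \<equiv> \<lambda>i x. (\<bar>w' $ i \<bullet> x\<bar> - sgn (w $ i \<bullet> x) * (w' $ i \<bullet> x)) / 2"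
    and "d \<equiv> \<lambda>i x. relu (w' $ i \<bullet> x) - relu (w $ i \<bullet> x)"
  shows "loss_F v w' - loss_F v w - loss_linear_part v w (w' - w)
    = (\<Sum>i\<in>UNIV. \<Sum>l\<in>UNIV. (\<integral>x. relu (w $ l \<bullet> x) * R i x \<partial>std_gauss) + (\<integral>x. d i x * d l x \<partial>std_gauss) / 2)
      - (\<Sum>i\<in>UNIV. \<Sum>j\<in>UNIV. (\<integral>x. relu (v $ j \<bullet> x) * R i x \<partial>std_gauss))"
proof -
  define p where "p x = (\<Sum>i\<in>UNIV. relu (w $ i \<bullet> x))" for x
  define q where "q x = (\<Sum>i\<in>UNIV. relu (w' $ i \<bullet> x))" for x
  define t where "t x = (\<Sum>j\<in>UNIV. relu (v $ j \<bullet> x))" for x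
  define g where "g i x = (1 + sgn (w $ i \<bullet> x)) / 2 * ((w' - w) $ i \<bullet> x)" for i x
  define G where "G x = (\<Sum>i\<in>UNIV. g i x)" for x
  have d_eq: "d i x = g i x + R i x" for i x
    unfolding d_def g_def R_def relu_linearisation by (simp add: inner_diff_left)
  have lR: "linear_growth (R i)" for i
    unfolding R_def by (rule linear_growth_inner_bound[of _ "w' $ i"]) (auto simp: sgn_if)
  have lg: "linear_growth (g i)" for i
    unfolding g_def by (rule linear_growth_inner_bound[of _ "(w' - w) $ i"]) (auto simp: sgn_if abs_mult)
  have ld: "linear_growth (d i)" for i
    unfolding d_def by (intro linear_growth_diff linear_growth_relu)
  have lp: "linear_growth p" and lq: "linear_growth q" and lt: "linear_growth t"
    unfolding p_def q_def t_def by (intro linear_growth_sum linear_growth_relu)+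
  have lG: "linear_growth G" unfolding G_def by (intro linear_growth_sum lg)
  note int = integrable_std_gauss_linear_growth_mult
  have qp: "q x - p x = (\<Sum>i\<in>UNIV. d i x)" for x
    by (simp add: q_def p_def d_def sum_subtractf)
  have pw: "1/2 * (q x - t x)\<^sup>2 - 1/2 * (p x - t x)\<^sup>2 - (p x - t x) * G x
      = (\<Sum>i\<in>UNIV. \<Sum>l\<in>UNIV. relu (w $ l \<bullet> x) * R i x + d i x * d l x / 2)
        - (\<Sum>i\<in>UNIV. \<Sum>j\<in>UNIV. relu (v $ j \<bullet> x) * R i x)" for x
  proof -
    define S where "S = (\<Sum>i\<in>UNIV. d i x)"
    define RR where "RR = (\<Sum>i\<in>UNIV. R i x)"
    have "S = G x + RR" by (simp add: S_def G_def RR_def d_eq sum.distrib)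
    moreover have "q x = p x + S" using qp[of x] by (simp add: S_def)
    ultimately have "1/2 * (q x - t x)\<^sup>2 - 1/2 * (p x - t x)\<^sup>2 - (p x - t x) * G x
      = p x * RR + S * S / 2 - t x * RR"
      by (simp add: power2_eq_square field_simps)
    moreover have "p x * RR = (\<Sum>i\<in>UNIV. \<Sum>l\<in>UNIV. relu (w $ l \<bullet> x) * R i x)"
      unfolding p_def RR_def by (simp add: sum_product) (rule sum.swap)
    moreover have "t x * RR = (\<Sum>i\<in>UNIV. \<Sum>l\<in>UNIV. relu (v $ l \<bullet> x) * R i x)"
      unfolding t_def RR_def by (simp add: sum_product) (rule sum.swap)
    moreover have "S * S / 2 = (\<Sum>i\<in>UNIV. \<Sum>l\<in>UNIV. d i x * d l x / 2)"
      unfolding S_def by (simp add: sum_product sum_divide_distrib)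
    ultimately show ?thesis by (simp add: sum.distrib)
  qed
  have "loss_F v w' - loss_F v w - loss_linear_part v w (w' - w)
    = (\<integral>x. 1/2 * (q x - t x)\<^sup>2 - 1/2 * (p x - t x)\<^sup>2 - (p x - t x) * G x \<partial>std_gauss)"
  proof -
    have i1: "integrable std_gauss (\<lambda>x. 1/2 * (q x - t x)\<^sup>2)" "integrable std_gauss (\<lambda>x. 1/2 * (p x - t x)\<^sup>2)"
      unfolding power2_eq_square by (intro integrable_mult_right int linear_growth_diff lp lq lt)+
    have i2: "integrable std_gauss (\<lambda>x. (p x - t x) * G x)"
      by (intro int linear_growth_diff lp lt lG)
    show ?thesis
      unfolding loss_F_def loss_linear_part_def p_def[symmetric] q_def[symmetric] t_def[symmetric]
        g_def[symmetric] G_def[symmetric]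
      using i1 i2 by (simp only: Bochner_Integration.integral_diff Bochner_Integration.integrable_diff)
  qed
  also have "\<dots> = (\<integral>x. (\<Sum>i\<in>UNIV. \<Sum>l\<in>UNIV. relu (w $ l \<bullet> x) * R i x + d i x * d l x / 2)
        - (\<Sum>i\<in>UNIV. \<Sum>j\<in>UNIV. relu (v $ j \<bullet> x) * R i x) \<partial>std_gauss)"
    unfolding pw ..
  also have "\<dots> = (\<Sum>i\<in>UNIV. \<Sum>l\<in>UNIV. (\<integral>x. relu (w $ l \<bullet> x) * R i x \<partial>std_gauss) + (\<integral>x. d i x * d l x \<partial>std_gauss) / 2)
      - (\<Sum>i\<in>UNIV. \<Sum>j\<in>UNIV. (\<integral>x. relu (v $ j \<bullet> x) * R i x \<partial>std_gauss))"
  proof -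
    have i: "integrable std_gauss (\<lambda>x. relu (u \<bullet> x) * R i x)" for u i
      by (intro int linear_growth_relu lR)
    have j: "integrable std_gauss (\<lambda>x. d i x * d l x / 2)" for i l
      by (intro integrable_divide_zero int ld)
    show ?thesis
      by (simp add: i j Bochner_Integration.integral_diff Bochner_Integration.integral_sum
          Bochner_Integration.integral_add Bochner_Integration.integrable_sum Bochner_Integration.integrable_add)
  qed
  finally show ?thesis .
qed

text \<open>Each one-sided bound discards the terms of favourable sign: the upper one drops the
  nonnegative \<open>T\<close>, the lower one drops \<open>P\<close> and \<open>Q\<close>. The
  \<open>P\<close> are nonnegative one by one, the \<open>Q\<close> only in total, their double sum
  being the integral of a square.\<close>

lemma loss_F_remainder:
  fixes v :: "(real ^ 'k::finite) ^ 'k" and w w' :: "(real ^ 'k) ^ 'n::finite"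
  assumes m: "0 < m" "\<And>i. m \<le> norm (w $ i)" and M: "\<And>i. norm (w $ i) \<le> M"
    and V: "\<And>j. norm (v $ j) \<le> V"
  shows "loss_F v w' - loss_F v w - loss_linear_part v w (w' - w)
      \<le> (1/2 + (real CARD('n) - 1) * (M / (2 * pi * m) + 1/2)) * (norm (w' - w))\<^sup>2"
    and "- (real CARD('k) * V / (2 * pi * m) * (norm (w' - w))\<^sup>2)
      \<le> loss_F v w' - loss_F v w - loss_linear_part v w (w' - w)"
proof -
  define R where "R i x = (\<bar>w' $ i \<bullet> x\<bar> - sgn (w $ i \<bullet> x) * (w' $ i \<bullet> x)) / 2" for i x
  define d where "d i x = relu (w' $ i \<bullet> x) - relu (w $ i \<bullet> x)" for i x
  define e where "e i = (norm (w' $ i - w $ i))\<^sup>2" for i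
  define P where "P i l = (\<integral>x. relu (w $ l \<bullet> x) * R i x \<partial>std_gauss)" for i l
  define Q where "Q i l = (\<integral>x. d i x * d l x \<partial>std_gauss)" for i l
  define T where "T i j = (\<integral>x. relu (v $ j \<bullet> x) * R i x \<partial>std_gauss)" for i j
  define \<mu> where "\<mu> = M / (2 * pi * m)"
  have expan: "loss_F v w' - loss_F v w - loss_linear_part v w (w' - w)
    = (\<Sum>i\<in>UNIV. \<Sum>l\<in>UNIV. P i l + Q i l / 2) - (\<Sum>i\<in>UNIV. \<Sum>j\<in>UNIV. T i j)"
    using loss_F_expansion[of v w' w] unfolding P_def Q_def T_def R_def d_def .
  have norm_h: "(norm (w' - w))\<^sup>2 = (\<Sum>i\<in>UNIV. e i)"
    unfolding power2_norm_eq_inner inner_vec_def[of "w' - w"] e_def by simp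
  have e0: "0 \<le> e i" for i by (simp add: e_def)
  have lR: "linear_growth (R i)" for i
    unfolding R_def by (rule linear_growth_inner_bound[of _ "w' $ i"]) (auto simp: sgn_if)
  have ld: "linear_growth (d i)" for i
    unfolding d_def by (intro linear_growth_diff linear_growth_relu)
  note int = integrable_std_gauss_linear_growth_mult
  have R0: "0 \<le> R i x" for i x unfolding R_def by (rule relu_linearisation_error_nonneg)
  have relu0: "0 \<le> relu y" for y by (simp add: relu_def)
  have d_le: "\<bar>d i x\<bar> \<le> \<bar>(w' $ i - w $ i) \<bullet> x\<bar>" for i x
    unfolding d_def inner_diff_left by (rule abs_relu_diff_le)
  have neuron: "(\<integral>x. relu (u \<bullet> x) * R i x \<partial>std_gauss) \<le> U / (2 * pi * m) * e i" if "norm u \<le> U" for u U i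
  proof -
    have wi: "0 < norm (w $ i)" using m(1) m(2)[of i] by linarith
    then have "(\<integral>x. relu (u \<bullet> x) * R i x \<partial>std_gauss) \<le> norm u * e i / (2 * pi * norm (w $ i))"
      unfolding R_def e_def by (intro integral_std_gauss_relu_linearisation) auto
    also have "\<dots> \<le> U * e i / (2 * pi * m)"
      using m m(2)[of i] that e0[of i] order_trans[OF norm_ge_zero that]
      by (intro frac_le mult_mono mult_pos_pos) auto
    finally show ?thesis by simp
  qed
  have P0: "0 \<le> P i l" for i l
    unfolding P_def using R0 relu0 by (intro Bochner_Integration.integral_nonneg) auto
  have T0: "0 \<le> T i l" for i l
    unfolding T_def using R0 relu0 by (intro Bochner_Integration.integral_nonneg) auto
  have P_le: "P i l \<le> \<mu> * e i" for i l unfolding P_def \<mu>_def by (intro neuron M)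
  have T_le: "T i j \<le> V / (2 * pi * m) * e i" for i j unfolding T_def by (intro neuron V)
  have Q_le: "Q i l \<le> (e i + e l) / 2" for i l
  proof -
    have "Q i l \<le> (\<integral>x. (((w' $ i - w $ i) \<bullet> x)\<^sup>2 + ((w' $ l - w $ l) \<bullet> x)\<^sup>2) / 2 \<partial>std_gauss)"
      unfolding Q_def
    proof (intro integral_mono int ld integrable_divide_zero Bochner_Integration.integrable_add
        integrable_std_gauss_inner_sq)
      fix x
      have "d i x * d l x \<le> \<bar>d i x\<bar> * \<bar>d l x\<bar>" by (metis abs_ge_self abs_mult)
      also have "\<dots> \<le> \<bar>(w' $ i - w $ i) \<bullet> x\<bar> * \<bar>(w' $ l - w $ l) \<bullet> x\<bar>"
        by (intro mult_mono d_le) auto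
      also have "2 * \<dots> \<le> ((w' $ i - w $ i) \<bullet> x)\<^sup>2 + ((w' $ l - w $ l) \<bullet> x)\<^sup>2"
        using sum_squares_bound[of "\<bar>(w' $ i - w $ i) \<bullet> x\<bar>" "\<bar>(w' $ l - w $ l) \<bullet> x\<bar>"]
        by (simp add: mult.assoc)
      finally show "d i x * d l x \<le> (((w' $ i - w $ i) \<bullet> x)\<^sup>2 + ((w' $ l - w $ l) \<bullet> x)\<^sup>2) / 2" by simp
    qed
    also have "\<dots> = (e i + e l) / 2"
      unfolding e_def by (simp only: integral_divide_zero Bochner_Integration.integral_add
          integrable_std_gauss_inner_sq integral_std_gauss_inner_sq)
    finally show ?thesis .
  qed
  have diag: "P i i + Q i i / 2 \<le> e i / 2" for i
  proof -
    have "P i i + Q i i / 2 = (\<integral>x. relu (w $ i \<bullet> x) * R i x + d i x * d i x / 2 \<partial>std_gauss)"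
      unfolding P_def Q_def
      by (subst Bochner_Integration.integral_add) (auto intro!: int linear_growth_relu lR ld)
    also have "\<dots> \<le> (\<integral>x. ((w' $ i - w $ i) \<bullet> x)\<^sup>2 / 2 \<partial>std_gauss)"
    proof (intro integral_mono Bochner_Integration.integrable_add int linear_growth_relu lR ld
        integrable_divide_zero integrable_std_gauss_inner_sq)
      fix x
      show "relu (w $ i \<bullet> x) * R i x + d i x * d i x / 2 \<le> ((w' $ i - w $ i) \<bullet> x)\<^sup>2 / 2"
        using relu_diagonal_bound[of "w $ i \<bullet> x" "w' $ i \<bullet> x"]
        unfolding R_def d_def inner_diff_left power2_eq_square .
    qed
    also have "\<dots> = e i / 2" unfolding e_def by (simp only: integral_divide_zero integral_std_gauss_inner_sq)
    finally show ?thesis .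
  qed
  let ?n = "real CARD('n)"
  \<comment> \<open>An off-diagonal pair costs \<open>\<mu> * e i + (e i + e l) / 4\<close>; on the
    diagonal the \<open>\<mu>\<close> term is taken away again, leaving exactly
    \<open>e i / 2\<close>. Summation gives \<open>?n * \<mu> + ?n / 2 - \<mu>\<close> times the sum
    of the \<open>e i\<close>.\<close>
  have "(\<Sum>i\<in>UNIV. \<Sum>l\<in>UNIV. P i l + Q i l / 2)
      \<le> (\<Sum>i\<in>UNIV. \<Sum>l\<in>UNIV. (\<mu> * e i + (e i + e l) / 4) - (if l = i then \<mu> * e i else 0))"
  proof (intro sum_mono)
    fix i l
    show "P i l + Q i l / 2 \<le> (\<mu> * e i + (e i + e l) / 4) - (if l = i then \<mu> * e i else 0)"
    proof (cases "l = i")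
      case True
      then show ?thesis using diag[of i] by simp
    next
      case False
      moreover have "Q i l / 2 \<le> (e i + e l) / 4" using Q_le[of i l] by linarith
      ultimately show ?thesis using P_le[of i l] by (simp only: if_False diff_0_right add_mono)
    qed
  qed
  also have "\<dots> = (1/2 + (?n - 1) * (\<mu> + 1/2)) * (norm (w' - w))\<^sup>2"
    unfolding norm_h
    by (simp add: sum_subtractf sum.distrib add_divide_distrib sum.delta
        flip: sum_distrib_left sum_divide_distrib) (simp add: field_simps)
  finally have ub: "(\<Sum>i\<in>UNIV. \<Sum>l\<in>UNIV. P i l + Q i l / 2) \<le> (1/2 + (?n - 1) * (\<mu> + 1/2)) * (norm (w' - w))\<^sup>2" .
  have "0 \<le> (\<Sum>i\<in>UNIV. \<Sum>j\<in>UNIV. T i j)" by (intro sum_nonneg T0)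
  with ub show "loss_F v w' - loss_F v w - loss_linear_part v w (w' - w)
      \<le> (1/2 + (?n - 1) * (M / (2 * pi * m) + 1/2)) * (norm (w' - w))\<^sup>2"
    unfolding expan \<mu>_def by linarith
  have "0 \<le> (\<Sum>i\<in>UNIV. \<Sum>l\<in>UNIV. P i l + Q i l / 2)"
  proof -
    have "(\<Sum>i\<in>UNIV. \<Sum>l\<in>UNIV. Q i l) = (\<integral>x. (\<Sum>i\<in>UNIV. \<Sum>l\<in>UNIV. d i x * d l x) \<partial>std_gauss)"
      unfolding Q_def by (simp add: Bochner_Integration.integral_sum Bochner_Integration.integrable_sum int ld)
    also have "\<dots> = (\<integral>x. (\<Sum>i\<in>UNIV. d i x)\<^sup>2 \<partial>std_gauss)"
      by (simp add: power2_eq_square sum_product)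
    finally have "0 \<le> (\<Sum>i\<in>UNIV. \<Sum>l\<in>UNIV. Q i l)" by simp
    moreover have "0 \<le> (\<Sum>i\<in>UNIV. \<Sum>l\<in>UNIV. P i l)" by (intro sum_nonneg P0)
    ultimately show ?thesis by (simp add: sum.distrib flip: sum_divide_distrib)
  qed
  moreover have "(\<Sum>i\<in>UNIV. \<Sum>j\<in>UNIV. T i j) \<le> real CARD('k) * V / (2 * pi * m) * (norm (w' - w))\<^sup>2"
  proof -
    have "(\<Sum>i\<in>UNIV. \<Sum>j\<in>UNIV. T i j) \<le> (\<Sum>i\<in>UNIV. \<Sum>j\<in>(UNIV::'k set). V / (2 * pi * m) * e i)"
      by (intro sum_mono T_le)
    also have "\<dots> = real CARD('k) * V / (2 * pi * m) * (norm (w' - w))\<^sup>2"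
      unfolding norm_h by (simp add: sum_distrib_left mult.assoc)
    finally show ?thesis .
  qed
  ultimately show "- (real CARD('k) * V / (2 * pi * m) * (norm (w' - w))\<^sup>2)
      \<le> loss_F v w' - loss_F v w - loss_linear_part v w (w' - w)"
    unfolding expan by linarith
qed

text \<open>Along \<open>t \<mapsto> w + t *\<^sub>R h\<close> the remainder is of order
  \<open>t\<^sup>2\<close>, so the difference quotient tends to \<open>L h\<close>, by homogeneity
  of \<open>L\<close>; the gradient gives the limit \<open>h \<bullet> D\<close>.\<close>

lemma gderiv_eq_of_quadratic_remainder:
  fixes f :: "'a::real_inner \<Rightarrow> real" and L :: "'a \<Rightarrow> real"
  assumes D: "GDERIV f w :> D"
    and hom: "\<And>t h. L (t *\<^sub>R h) = t * L h"
    and rem: "\<And>h. \<bar>f (w + h) - f w - L h\<bar> \<le> B * (norm h)\<^sup>2"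
  shows "L h = h \<bullet> D"
proof -
  \<comment> \<open>Writing \<open>w\<close> as \<open>w + 0 *\<^sub>R h\<close> lets the chain rule
    match the base point of the line.\<close>
  have "(f has_derivative (\<lambda>h. h \<bullet> D)) (at (w + 0 *\<^sub>R h))" using D by (simp add: gderiv_def)
  moreover have "((\<lambda>t. w + t *\<^sub>R h) has_derivative (\<lambda>t. t *\<^sub>R h)) (at 0)"
    by (auto intro!: derivative_eq_intros)
  ultimately have "((\<lambda>t. f (w + t *\<^sub>R h)) has_derivative (\<lambda>t. (t *\<^sub>R h) \<bullet> D)) (at 0)"
    by (rule has_derivative_compose[rotated])
  then have d1: "((\<lambda>t. f (w + t *\<^sub>R h)) has_real_derivative h \<bullet> D) (at 0)"
    unfolding has_field_derivative_def by (simp add: mult_commute_abs)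
  have "((\<lambda>t. (f (w + t *\<^sub>R h) - f w) / t - L h) \<longlongrightarrow> 0) (at 0)"
  proof (rule Lim_null_comparison)
    show "\<forall>\<^sub>F t in at 0. norm ((f (w + t *\<^sub>R h) - f w) / t - L h) \<le> B * (norm h)\<^sup>2 * \<bar>t\<bar>"
      unfolding eventually_at_filter
    proof (intro always_eventually allI impI)
      fix t :: real assume t: "t \<noteq> 0"
      have "\<bar>(f (w + t *\<^sub>R h) - f w) / t - L h\<bar> = \<bar>f (w + t *\<^sub>R h) - f w - L (t *\<^sub>R h)\<bar> / \<bar>t\<bar>"
        using t by (simp add: hom field_simps flip: abs_divide)
      also have "\<dots> \<le> B * (norm (t *\<^sub>R h))\<^sup>2 / \<bar>t\<bar>"
        by (intro divide_right_mono rem) auto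
      also have "\<dots> = B * (norm h)\<^sup>2 * \<bar>t\<bar>"
        using t by (simp add: power_mult_distrib power2_eq_square field_simps)
      finally show "norm ((f (w + t *\<^sub>R h) - f w) / t - L h) \<le> B * (norm h)\<^sup>2 * \<bar>t\<bar>" by simp
    qed
    show "((\<lambda>t. B * (norm h)\<^sup>2 * \<bar>t\<bar>) \<longlongrightarrow> 0) (at 0)"
      by (auto intro!: tendsto_eq_intros)
  qed
  then have "((\<lambda>t. (f (w + t *\<^sub>R h) - f w) / t) \<longlongrightarrow> L h) (at 0)"
    by (simp add: LIM_zero_iff)
  then have "((\<lambda>t. f (w + t *\<^sub>R h)) has_real_derivative L h) (at 0)"
    by (simp add: DERIV_def)
  then show ?thesis using d1 DERIV_unique by blast
qed

theorem theorem4: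
  fixes v :: "(real ^ 'k::finite) ^ 'k"
    and A :: "((real ^ 'k) ^ 'n::finite) set"
    and w w' D :: "(real ^ 'k) ^ 'n"
  assumes "compact A"
    and "thrice_differentiable_on (loss_F v) A"
    and "(INF u\<in>A. Min (range (\<lambda>i. norm (u $ i)))) > 0"
    and "w \<in> A" and "w' \<in> A"
    and "GDERIV (loss_F v) w :> D"
  shows "let mA = (INF u\<in>A. Min (range (\<lambda>i. norm (u $ i))));
             MA = (SUP u\<in>A. Max (range (\<lambda>i. norm (u $ i))));
             V = Max (range (\<lambda>j. norm (v $ j)));
             n = real CARD('n); k = real CARD('k);
             LH = 1/2 + n * (n - 1) * (MA / (2 * pi * mA) + 1/2) + n * k * V / (2 * pi * mA)
         in \<bar>loss_F v w' - loss_F v w\<bar> \<le> norm (w' - w) * (LH * norm (w' - w) + norm D)"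
proof -
  define mA where "mA = (INF u\<in>A. Min (range (\<lambda>i. norm (u $ i))))"
  define MA where "MA = (SUP u\<in>A. Max (range (\<lambda>i. norm (u $ i))))"
  define V where "V = Max (range (\<lambda>j. norm (v $ j)))"
  let ?n = "real CARD('n)" and ?k = "real CARD('k)"
  define LH where "LH = 1/2 + ?n * (?n - 1) * (MA / (2 * pi * mA) + 1/2) + ?n * ?k * V / (2 * pi * mA)"
  have m0: "0 < mA" using assms(3) by (simp add: mA_def)
  have m: "mA \<le> norm (w $ i)" for i
  proof -
    have "bdd_below ((\<lambda>u. Min (range (\<lambda>i. norm (u $ i)))) ` A)"
      by (rule bdd_belowI[of _ 0]) auto
    then have "mA \<le> Min (range (\<lambda>i. norm (w $ i)))"
      unfolding mA_def using assms(4) by (rule cINF_lower)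
    also have "\<dots> \<le> norm (w $ i)" by (rule Min_le) auto
    finally show ?thesis .
  qed
  have M: "norm (w $ i) \<le> MA" for i
  proof -
    \<comment> \<open>Compactness makes the maxima bounded above on \<open>A\<close>, so that
      \<open>MA\<close> is a genuine upper bound.\<close>
    obtain B where B: "norm u \<le> B" if "u \<in> A" for u
      using compact_imp_bounded[OF assms(1)] by (auto simp: bounded_iff)
    have "bdd_above ((\<lambda>u. Max (range (\<lambda>i. norm (u $ i)))) ` A)"
    proof (rule bdd_aboveI2)
      fix u assume "u \<in> A"
      then show "Max (range (\<lambda>i. norm (u $ i))) \<le> B"
        using B Finite_Cartesian_Product.norm_nth_le order_trans by (auto simp: Max_le_iff) blast
    qed
    then have "Max (range (\<lambda>i. norm (w $ i))) \<le> MA"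
      unfolding MA_def using assms(4) by (rule cSUP_upper[rotated])
    moreover have "norm (w $ i) \<le> Max (range (\<lambda>i. norm (w $ i)))" by (rule Max_ge) auto
    ultimately show ?thesis by linarith
  qed
  have V: "norm (v $ j) \<le> V" for j unfolding V_def by (rule Max_ge) auto
  have M0: "0 \<le> MA" using M norm_ge_zero order_trans by blast
  have V0: "0 \<le> V" using V norm_ge_zero order_trans by blast
  have n1: "1 \<le> ?n" by (simp add: Suc_le_eq)
  have \<mu>0: "0 \<le> MA / (2 * pi * mA)" and \<nu>0: "0 \<le> ?k * V / (2 * pi * mA)"
    using M0 m0 V0 by auto
  \<comment> \<open>\<open>LH\<close> has \<open>?n * (?n - 1)\<close> and \<open>?n * ?k\<close>
    where the remainder bounds have \<open>?n - 1\<close> and \<open>?k\<close>; index types are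
    nonempty, so \<open>?n \<ge> 1\<close> covers the difference.\<close>
  have LH1: "1/2 + (?n - 1) * (MA / (2 * pi * mA) + 1/2) \<le> LH"
  proof -
    have "1 * ((?n - 1) * (MA / (2 * pi * mA) + 1/2)) \<le> ?n * ((?n - 1) * (MA / (2 * pi * mA) + 1/2))"
      using n1 \<mu>0 by (intro mult_right_mono mult_nonneg_nonneg) auto
    moreover have "0 \<le> ?n * (?k * V / (2 * pi * mA))" using \<nu>0 by (intro mult_nonneg_nonneg) auto
    ultimately show ?thesis by (simp add: LH_def mult.assoc)
  qed
  have LH2: "?k * V / (2 * pi * mA) \<le> LH"
  proof -
    have "1 * (?k * V / (2 * pi * mA)) \<le> ?n * (?k * V / (2 * pi * mA))"
      using n1 \<nu>0 by (intro mult_right_mono) auto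
    moreover have "0 \<le> ?n * (?n - 1) * (MA / (2 * pi * mA) + 1/2)"
      using n1 \<mu>0 by (intro mult_nonneg_nonneg) auto
    ultimately show ?thesis by (simp add: LH_def mult.assoc)
  qed
  \<comment> \<open>The estimate holds for every \<open>h\<close>, whether or not
    \<open>w + h\<close> lies in \<open>A\<close>; identifying the gradient requires all small
    \<open>h\<close>.\<close>
  have rem: "\<bar>loss_F v (w + h) - loss_F v w - loss_linear_part v w h\<bar> \<le> LH * (norm h)\<^sup>2" for h
    using loss_F_remainder[OF m0 m M V, of "w + h"]
      mult_right_mono[OF LH1, of "(norm h)\<^sup>2"] mult_right_mono[OF LH2, of "(norm h)\<^sup>2"] by simp
  have "loss_linear_part v w h = h \<bullet> D" for h
    using assms(6) loss_linear_part_scaleR rem by (rule gderiv_eq_of_quadratic_remainder)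
  then have "\<bar>loss_F v w' - loss_F v w - (w' - w) \<bullet> D\<bar> \<le> LH * (norm (w' - w))\<^sup>2"
    using rem[of "w' - w"] by simp
  moreover have "\<bar>(w' - w) \<bullet> D\<bar> \<le> norm (w' - w) * norm D" by (rule Cauchy_Schwarz_ineq2)
  ultimately have "\<bar>loss_F v w' - loss_F v w\<bar> \<le> norm (w' - w) * (LH * norm (w' - w) + norm D)"
    by (simp add: power2_eq_square algebra_simps)
  then show ?thesis by (simp add: Let_def LH_def mA_def MA_def V_def)
qed

end
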